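(* Let $-1<q<1$. For all $x$ with $|x|\le 1$ and all (real or complex) $a,b,c,d$ with $|a|,|b|,|c|,|d|<1$, $$f_{AW}(x|a,b,c,d,q)=f_h(x|q)\sum_{n\ge 0}\frac{\sigma_n^{(4)}(a,b,c,d|q)}{(q)_n}\,h_n(x|q),$$ where $$\sigma_n^{(4)}(a,b,c,d|q)=\sum_{j=0}^{n}\binom{n}{j}_q\frac{(bd)_j}{(abcd)_j}\,S_{n-j}^{(2)}(b,d|q)\sum_{k=0}^{j}\binom{j}{k}_q (cb)_k\,a^k\,(ad)_{j-k}\,c^{j-k}$$ are symmetric functions of $a,b,c,d$.
   Context: Notation (with $-1<q<1$, $0^0=1$): $(a)_n=(a;q)_n=\prod_{j=0}^{n-1}(1-aq^j)$, $(a)_0=1$, $(a)_\infty=\prod_{j\ge 0}(1-aq^j)$, $(a_1,\ldots,a_k)_\infty=\prod_{j=1}^k (a_j)_\infty$; $(q)_n=(q;q)_n=\prod_{j=1}^n(1-q^j)$; $\binom{n}{k}_q=\frac{(q)_n}{(q)_{n-k}(q)_k}$ for $0\le k\le n$ and $0$ otherwise. The continuous $q$-Hermite polynomials $h_n(x|q)$ are given by $h_{-1}=0$, $h_0=1$, $h_{n+1}(x|q)=2x\,h_n(x|q)-(1-q^n)h_{n-1}(x|q)$. Their orthogonalizing density on $[-1,1]$ is $$f_h(x|q)=\frac{2(q)_\infty\sqrt{1-x^2}}{\pi}\prod_{k=1}^\infty l(x|q^k),\qquad l(x|a)=(1+a)^2-4ax^2,$$ and their generating function is, for $|t|<1$,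 $$\varphi_h(x|t,q)=\sum_{j\ge0}\frac{t^j}{(q)_j}h_j(x|q)=\frac{1}{\prod_{k=0}^\infty v(x|tq^k)},\qquad v(x|t)=1-2tx+t^2.$$ $S_n^{(2)}(a,b|q)=\sum_{k=0}^n\binom{n}{k}_q a^k b^{n-k}$. The Askey--Wilson density is $$f_{AW}(x|a,b,c,d,q)=\frac{(ab,ac,ad,bc,bd,cd)_\infty}{(abcd)_\infty}\,f_h(x|q)\,\varphi_h(x|a,q)\varphi_h(x|b,q)\varphi_h(x|c,q)\varphi_h(x|d,q).$$ *)

theory Defs
  imports "HOL-Analysis.Analysis" "HOL-Library.Multiset"
begin

text \<open>
  The base \<open>q\<close> is always the first argument. Since \<open>0 ^ 0 = 1\<close>, the case \<open>q = 0\<close> needs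
  no special treatment.
\<close>

definition qpoch :: "'a::comm_ring_1 \<Rightarrow> 'a \<Rightarrow> nat \<Rightarrow> 'a" where
  "qpoch q a n = (\<Prod>j<n. 1 - a * q ^ j)"

definition qpoch_inf :: "'a::real_normed_field \<Rightarrow> 'a \<Rightarrow> 'a" where
  "qpoch_inf q a = (\<Prod>j. 1 - a * q ^ j)"

definition qbinom :: "'a::field \<Rightarrow> nat \<Rightarrow> nat \<Rightarrow> 'a" where
  "qbinom q n k = (if k \<le> n then qpoch q q n / (qpoch q q (n - k) * qpoch q q k) else 0)"

text \<open>
  Continuous \<open>q\<close>-Hermite polynomials; the value \<open>2 * x\<close> at index 1 is the three-term
  recurrence at \<open>n = 0\<close> with \<open>h\<^sub>-\<^sub>1 = 0\<close>.
\<close>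

fun q_hermite :: "'a::comm_ring_1 \<Rightarrow> nat \<Rightarrow> 'a \<Rightarrow> 'a" where
  "q_hermite q 0 x = 1"
| "q_hermite q (Suc 0) x = 2 * x"
| "q_hermite q (Suc (Suc n)) x =
     2 * x * q_hermite q (Suc n) x - (1 - q ^ Suc n) * q_hermite q n x"

definition l_fun :: "real \<Rightarrow> real \<Rightarrow> real" where
  "l_fun x a = (1 + a)\<^sup>2 - 4 * a * x\<^sup>2"

definition f_h :: "real \<Rightarrow> real \<Rightarrow> real" where
  "f_h q x = 2 * qpoch_inf q q * sqrt (1 - x\<^sup>2) / pi * (\<Prod>k. l_fun x (q ^ Suc k))"

definition phi_h :: "real \<Rightarrow> complex \<Rightarrow> real \<Rightarrow> complex" where
  "phi_h q t x = (\<Sum>j. t ^ j / of_real (qpoch q q j) * of_real (q_hermite q j x))"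

definition f_AW :: "real \<Rightarrow> complex \<Rightarrow> complex \<Rightarrow> complex \<Rightarrow> complex \<Rightarrow> real \<Rightarrow> complex" where
  "f_AW q a b c d x =
     (let P = qpoch_inf (complex_of_real q) in
       P (a * b) * P (a * c) * P (a * d) * P (b * c) * P (b * d) * P (c * d) / P (a * b * c * d)
       * of_real (f_h q x) * phi_h q a x * phi_h q b x * phi_h q c x * phi_h q d x)"

definition S2 :: "'a::field \<Rightarrow> nat \<Rightarrow> 'a \<Rightarrow> 'a \<Rightarrow> 'a" where
  "S2 q n a b = (\<Sum>k\<le>n. qbinom q n k * a ^ k * b ^ (n - k))"

definition sigma4 :: "'a::field \<Rightarrow> nat \<Rightarrow> 'a \<Rightarrow> 'a \<Rightarrow> 'a \<Rightarrow> 'a \<Rightarrow> 'a" where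
  "sigma4 q n a b c d =
     (\<Sum>j\<le>n. qbinom q n j * (qpoch q (b * d) j / qpoch q (a * b * c * d) j) * S2 q (n - j) b d
        * (\<Sum>k\<le>j. qbinom q j k * qpoch q (c * b) k * a ^ k * qpoch q (a * d) (j - k) * c ^ (j - k)))"

end

theory Submission
  imports Defs "HOL-Computational_Algebra.Formal_Power_Series"
begin

text \<open>
  Write \<open>AW_series\<close> for the series \<open>\<Sum>n. \<sigma>\<^sub>n h\<^sub>n / (q)\<^sub>n\<close> and \<open>AW_product\<close> for the density divided
  by \<open>f\<^sub>h\<close>. Seen as functions of \<open>a\<close>, both satisfy the same first-order \<open>q\<close>-difference equation
  \[ (1-ab)(1-ac)(1-ad)\, F(qa) = (1-abcd)\,(1-2ax+a^2)\, F(a) . \]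
  For the product this is immediate once it is known for \<open>\<phi>\<^sub>h\<close>, which is the series with
  \<open>b = c = d = 0\<close>. Iterating the equation drives \<open>a\<close> to \<open>0\<close> along \<open>a q^N\<close>, both sides converge, and
  so equality at \<open>a\<close> follows from equality and nonvanishing at \<open>a = 0\<close>
  (\<open>linear_recurrence_eq_of_tendsto\<close>). Since both sides are symmetric in the four parameters, this
  reduction removes one parameter after another until all are \<open>0\<close>, where both sides equal \<open>1\<close>.

  In terms of coefficients, multiplication by \<open>2x\<close> is the three-term recurrence of \<open>h\<^sub>n\<close>, and the
  equation for the series becomes the contiguous relation \<open>sigma4_contiguous\<close>, which expresses
  \<open>\<sigma>\<^sub>n(qa,b,c,d)\<close> by \<open>\<sigma>\<^sub>n\<close>, \<open>\<sigma>\<^bsub>n+1\<^esub>\<close> and \<open>\<sigma>\<^bsub>n-1\<^esub>\<close> at \<open>(a,b,c,d)\<close>. The same relation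
  gives the symmetry: for \<open>a \<noteq> 0\<close> it determines \<open>\<sigma>\<^bsub>n+1\<^esub>\<close> from earlier values, and its coefficients are
  symmetric in \<open>b, c, d\<close>.

  The contiguous relation is proved with formal power series. The inner sums of \<open>\<sigma>\<^sub>n\<close>
  (\<open>asc\<close> below) have an exponential-type generating function that is a product of two \<open>q\<close>-binomial
  series, and each of these is multiplied by a ratio of linear factors under \<open>t \<mapsto> qt\<close>. This gives a
  three-term recurrence (\<open>asc_rec\<close>) and a rule for \<open>a \<mapsto> qa\<close> (\<open>asc_shift\<close>), which combine to
  \<open>asc_contiguous\<close>, the coefficient form of the required identity.

  Convergence rests on \<open>\<bar>h\<^sub>n(x)\<bar> \<le> C (n + 1)\<close> for \<open>\<bar>x\<bar> \<le> 1\<close>, which holds because \<open>h\<^sub>n(x)\<close> is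
  \<open>S\<^sub>n(z, z')\<close> for conjugate points \<open>z, z'\<close> of the unit circle, and on \<open>\<bar>\<sigma>\<^sub>n\<bar> \<le> C (n + 1)^3 r^n\<close>,
  uniformly for parameters of modulus at most \<open>r < 1\<close>.
\<close>

section \<open>Dilations of formal power series and the \<open>q\<close>-binomial series\<close>

lemma qpoch_0 [simp]: "qpoch q a 0 = 1"
  by (simp add: qpoch_def)

lemma qpoch_Suc: "qpoch q a (Suc n) = qpoch q a n * (1 - a * q ^ n)"
  by (simp add: qpoch_def)

lemma qpoch_zero_left [simp]: "qpoch q 0 n = 1"
  by (simp add: qpoch_def)

lemma qpoch_shift: "(1 - a) * qpoch q (q * a) n = qpoch q a (Suc n)"
  unfolding qpoch_def prod.lessThan_Suc_shift by (simp add: mult_ac)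

lemma qpoch_q_nonzero:
  fixes q :: "'a::field"
  assumes "\<And>n. q ^ Suc n \<noteq> 1"
  shows "qpoch q q n \<noteq> 0"
proof (induction n)
  case (Suc n)
  then show ?case using assms[of n] by (auto simp: qpoch_Suc)
qed simp

text \<open>
  The substitution \<open>t \<mapsto> qt\<close>.
\<close>

definition qdil :: "'a::comm_ring_1 \<Rightarrow> 'a fps \<Rightarrow> 'a fps" where
  "qdil q f = Abs_fps (\<lambda>n. q ^ n * fps_nth f n)"

text \<open>
  The generating function \<open>\<Sum>n. s\<^sub>n t^n / (q)\<^sub>n\<close>, which turns \<open>q\<close>-binomial convolutions into products.
\<close>

definition qegf :: "'a::field \<Rightarrow> (nat \<Rightarrow> 'a) \<Rightarrow> 'a fps" where
  "qegf q s = Abs_fps (\<lambda>n. s n / qpoch q q n)"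

lemma qdil_nth [simp]: "fps_nth (qdil q f) n = q ^ n * fps_nth f n"
  by (simp add: qdil_def)

lemma qegf_nth [simp]: "fps_nth (qegf q s) n = s n / qpoch q q n"
  by (simp add: qegf_def)

lemma qdil_mult: "qdil q (f * g) = qdil q f * qdil q g"
proof (rule fps_ext)
  fix n
  have "q ^ n * (fps_nth f i * fps_nth g (n - i))
      = q ^ i * fps_nth f i * (q ^ (n - i) * fps_nth g (n - i))" if "i \<in> {0..n}" for i
    using that power_add[of q i "n - i"] by (simp add: mult_ac)
  then have "q ^ n * (\<Sum>i=0..n. fps_nth f i * fps_nth g (n - i))
      = (\<Sum>i=0..n. q ^ i * fps_nth f i * (q ^ (n - i) * fps_nth g (n - i)))"
    unfolding sum_distrib_left by (rule sum.cong[OF refl])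
  then show "fps_nth (qdil q (f * g)) n = fps_nth (qdil q f * qdil q g) n"
    by (simp add: fps_mult_nth)
qed

lemma qegf_mult:
  fixes q :: "'a::field"
  assumes nz: "\<And>n. q ^ Suc n \<noteq> 1"
  shows "qegf q s * qegf q u = qegf q (\<lambda>n. \<Sum>k\<le>n. qbinom q n k * s k * u (n - k))"
proof (rule fps_ext)
  fix n
  have "(\<Sum>i=0..n. s i / qpoch q q i * (u (n - i) / qpoch q q (n - i)))
      = (\<Sum>k\<le>n. qbinom q n k * s k * u (n - k)) / qpoch q q n"
    by (simp add: sum_divide_distrib atMost_atLeast0, rule sum.cong)
      (auto simp: qbinom_def qpoch_q_nonzero[OF nz])
  then show "fps_nth (qegf q s * qegf q u) n
      = fps_nth (qegf q (\<lambda>n. \<Sum>k\<le>n. qbinom q n k * s k * u (n - k))) n"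
    by (simp add: fps_mult_nth)
qed

abbreviation lin :: "'a::comm_ring_1 \<Rightarrow> 'a fps" where
  "lin s \<equiv> 1 - fps_const s * fps_X"

lemma lin_mult_nth:
  "fps_nth (lin s * f) 0 = fps_nth f 0"
  "fps_nth (lin s * f) (Suc n) = fps_nth f (Suc n) - s * fps_nth f n"
  by (simp_all add: left_diff_distrib mult.assoc)

lemma fps_X_const_mult_nth:
  fixes f :: "'a::comm_ring_1 fps"
  shows "fps_nth (fps_X * (fps_const u * f)) (Suc n) = u * fps_nth f n"
  by simp

text \<open>
  The series \<open>\<Sum>n. (u)\<^sub>n (st)^n / (q)\<^sub>n\<close> is the expansion of \<open>(ust)\<^sub>\<infinity> / (st)\<^sub>\<infinity>\<close>; dividing its values at
  \<open>t\<close> and \<open>qt\<close> leaves only the first factors. This form of the \<open>q\<close>-binomial theorem makes sense in any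
  field, without infinite products.
\<close>

lemma q_binomial_series:
  fixes q u s :: "'a::field"
  assumes nz: "\<And>n. q ^ Suc n \<noteq> 1"
  defines "f \<equiv> \<lambda>u s. qegf q (\<lambda>n. qpoch q u n * s ^ n)"
  shows "lin s * f u s = lin (s * u) * qdil q (f u s)"
proof (rule fps_ext)
  fix n
  show "fps_nth (lin s * f u s) n = fps_nth (lin (s * u) * qdil q (f u s)) n"
  proof (cases n)
    case 0
    then show ?thesis by (simp add: lin_mult_nth f_def)
  next
    case (Suc m)
    have "1 - q * q ^ m \<noteq> 0" "qpoch q q m \<noteq> 0"
      using nz[of m] qpoch_q_nonzero[OF nz] by auto
    then show ?thesis
      unfolding Suc lin_mult_nth f_def qdil_nth qegf_nth qpoch_Suc
      by (simp add: divide_simps) (simp add: algebra_simps)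
  qed
qed

text \<open>
  The coefficient of \<open>t^n\<close> in the equation, for the difference of two solutions that agree below \<open>n\<close>,
  is \<open>(1 - q^n) h\<^sub>n = 0\<close>.
\<close>

lemma qdil_equation_unique:
  fixes q :: "'a::field"
  assumes nz: "\<And>n. q ^ Suc n \<noteq> 1"
    and f: "p * f = r * qdil q f" and g: "p * g = r * qdil q g"
    and p0: "fps_nth p 0 = 1" and r0: "fps_nth r 0 = 1"
    and fg: "fps_nth f 0 = fps_nth g 0"
  shows "f = g"
proof -
  have "fps_nth f n = fps_nth g n" for n
  proof (induction n rule: less_induct)
    case (less n)
    show ?case
    proof (cases n)
      case 0
      then show ?thesis using fg by simp
    next
      case (Suc m)
      define h where "h = f - g"
      have hd: "qdil q h = qdil q f - qdil q g"
        by (rule fps_ext) (simp add: h_def algebra_simps)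
      have h: "p * h = r * qdil q h"
        by (simp add: hd f g right_diff_distrib) (simp add: h_def f g right_diff_distrib)
      have z: "fps_nth h i = 0" if "i < n" for i
        using less[OF that] by (simp add: h_def)
      have top: "fps_nth (p' * h') n = fps_nth p' 0 * fps_nth h' n"
        if "\<And>i. i < n \<Longrightarrow> fps_nth h' i = 0" for p' h' :: "'a fps"
      proof -
        have "fps_nth (p' * h') n = (\<Sum>i=0..n. fps_nth p' i * fps_nth h' (n - i))"
          by (simp add: fps_mult_nth)
        also have "\<dots> = (\<Sum>i\<in>{0}. fps_nth p' i * fps_nth h' (n - i))"
          by (rule sum.mono_neutral_right) (use that in auto)
        finally show ?thesis by simp
      qed
      have "fps_nth h n = q ^ n * fps_nth h n"
        using top[of h p] top[of "qdil q h" r] z h p0 r0 by simp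
      then have "(1 - q ^ Suc m) * fps_nth h n = 0" by (simp add: Suc algebra_simps)
      then show ?thesis using nz[of m] by (simp add: h_def)
    qed
  qed
  then show ?thesis by (simp add: fps_ext)
qed

section \<open>Al-Salam--Chihara sums\<close>

text \<open>
  The inner sum of \<open>sigma4\<close>. With \<open>a = rw\<close>, \<open>c = r / w\<close> these are \<open>r^j\<close> times the Al-Salam--Chihara
  polynomials with parameters \<open>rb, rd\<close> in \<open>(w + 1/w) / 2\<close>.
\<close>

definition asc :: "'a::field \<Rightarrow> nat \<Rightarrow> 'a \<Rightarrow> 'a \<Rightarrow> 'a \<Rightarrow> 'a \<Rightarrow> 'a" where
  "asc q j a b c d = (\<Sum>k\<le>j. qbinom q j k * qpoch q (c * b) k * a ^ k
     * qpoch q (a * d) (j - k) * c ^ (j - k))"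

lemma qegf_asc:
  fixes q :: "'a::field"
  assumes nz: "\<And>n. q ^ Suc n \<noteq> 1"
  shows "qegf q (\<lambda>j. asc q j a b c d)
    = qegf q (\<lambda>n. qpoch q (c * b) n * a ^ n) * qegf q (\<lambda>n. qpoch q (a * d) n * c ^ n)"
  unfolding qegf_mult[OF nz] asc_def by (simp add: mult_ac)

text \<open>
  The generating function is formally \<open>(abct, acdt)\<^sub>\<infinity> / (at, ct)\<^sub>\<infinity>\<close>, which also makes visible the
  invariance under \<open>a \<leftrightarrow> c\<close> and under \<open>b \<leftrightarrow> d\<close>.
\<close>

lemma qegf_asc_equation:
  fixes q a b c d :: "'a::field"
  assumes nz: "\<And>n. q ^ Suc n \<noteq> 1"
  defines "F \<equiv> qegf q (\<lambda>j. asc q j a b c d)"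
  shows "lin a * (lin c * F) = lin (a * (c * b)) * (lin (c * (a * d)) * qdil q F)"
proof -
  define f where "f = (\<lambda>u s. qegf q (\<lambda>n. qpoch q u n * s ^ n))"
  have F: "F = f (c * b) a * f (a * d) c"
    unfolding F_def f_def by (rule qegf_asc[OF nz])
  have f: "lin s * f u s = lin (s * u) * qdil q (f u s)" for u s
    unfolding f_def by (rule q_binomial_series[OF nz])
  have "lin a * (lin c * F) = (lin a * f (c * b) a) * (lin c * f (a * d) c)"
    unfolding F by (simp only: mult_ac)
  also have "\<dots> = lin (a * (c * b)) * (lin (c * (a * d)) * qdil q F)"
    unfolding F qdil_mult f by (simp only: mult_ac)
  finally show ?thesis .
qed

lemma asc_0 [simp]: "asc q 0 a b c d = 1"
  by (simp add: asc_def qbinom_def)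

text \<open>
  Comparison of coefficients in the \<open>q\<close>-difference equation. At \<open>j = 0\<close> the truncated index
  \<open>j - 1\<close> is harmless because its coefficient \<open>1 - q^0\<close> vanishes.
\<close>

lemma asc_rec:
  fixes q :: "'a::field"
  assumes nz: "\<And>n. q ^ Suc n \<noteq> 1"
  shows "asc q (Suc j) a b c d = (a + c - a * c * (b + d) * q ^ j) * asc q j a b c d
    - (1 - q ^ j) * a * c * (1 - a * b * c * d * q ^ (j - 1)) * asc q (j - 1) a b c d"
proof -
  define F where "F = qegf q (\<lambda>j. asc q j a b c d)"
  have eq: "fps_nth (lin a * (lin c * F)) n
      = fps_nth (lin (a * (c * b)) * (lin (c * (a * d)) * qdil q F)) n" for n
    using qegf_asc_equation[OF nz] by (simp add: F_def)
  have asc: "asc q i a b c d = fps_nth F i * qpoch q q i" for i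
    using qpoch_q_nonzero[OF nz] by (simp add: F_def)
  show ?thesis
  proof (cases j)
    case 0
    have "fps_nth F (Suc 0) * (1 - q) = (a + c - a * c * (b + d)) * fps_nth F 0"
      using eq[of "Suc 0"] unfolding lin_mult_nth qdil_nth by (simp add: algebra_simps)
    then show ?thesis
      unfolding asc by (simp add: 0 qpoch_Suc)
  next
    case (Suc i)
    have "fps_nth F (Suc j) * (1 - q ^ Suc j) = (a + c - a * c * (b + d) * q ^ j) * fps_nth F j
        - a * c * (1 - a * b * c * d * q ^ i) * fps_nth F i"
      using eq[of "Suc (Suc i)"] unfolding lin_mult_nth qdil_nth Suc by (simp add: algebra_simps)
    then have "fps_nth F (Suc j) * (1 - q ^ Suc j) * qpoch q q j
      = ((a + c - a * c * (b + d) * q ^ j) * fps_nth F j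
        - a * c * (1 - a * b * c * d * q ^ i) * fps_nth F i) * qpoch q q j"
      by (rule arg_cong)
    also have "\<dots> = (a + c - a * c * (b + d) * q ^ j) * (fps_nth F j * qpoch q q j)
        - (1 - q ^ j) * a * c * (1 - a * b * c * d * q ^ i) * (fps_nth F i * qpoch q q i)"
      unfolding Suc qpoch_Suc by (simp add: algebra_simps)
    finally show ?thesis
      unfolding asc by (simp add: Suc qpoch_Suc mult_ac)
  qed
qed

text \<open>
  The recurrence and the initial value have both symmetries.
\<close>

lemma asc_sym:
  fixes q :: "'a::field"
  assumes nz: "\<And>n. q ^ Suc n \<noteq> 1"
  shows asc_swap_13: "asc q j a b c d = asc q j c b a d"
    and asc_swap_24: "asc q j a b c d = asc q j a d c b"
proof -
  have *: "asc q j a b c d = asc q j c b a d \<and> asc q j a b c d = asc q j a d c b"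
  proof (induction j rule: less_induct)
    case (less j)
    show ?case
    proof (cases j)
      case (Suc i)
      have "asc q i a b c d = asc q i c b a d \<and> asc q i a b c d = asc q i a d c b"
        and "asc q (i - 1) a b c d = asc q (i - 1) c b a d
          \<and> asc q (i - 1) a b c d = asc q (i - 1) a d c b"
        by (rule less; simp add: Suc)+
      then show ?thesis
        unfolding Suc asc_rec[OF nz] by (auto simp: algebra_simps)
    qed simp
  qed
  then show "asc q j a b c d = asc q j c b a d" "asc q j a b c d = asc q j a d c b"
    by auto
qed

text \<open>
  Replacing \<open>a\<close> by \<open>qa\<close> dilates the factor \<open>(abct)\<^sub>\<infinity> / (at)\<^sub>\<infinity>\<close>, and in the factor
  \<open>(acdt)\<^sub>\<infinity> / (ct)\<^sub>\<infinity>\<close> it removes \<open>1 - acdt\<close>. All terms then have a common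
  denominator, and the claim is a polynomial identity in \<open>t\<close>.
\<close>

lemma asc_shift:
  fixes q :: "'a::field"
  assumes nz: "\<And>n. q ^ Suc n \<noteq> 1"
  shows "c * (1 - a * b) * (1 - a * d) * asc q j (q * a) b c d
    = asc q (Suc j) a b c d - a * (1 - a * b * c * d * q ^ j) * asc q j a b c d"
proof -
  define X where "X = qegf q (\<lambda>n. qpoch q (c * b) n * a ^ n)"
  define Y where "Y = qegf q (\<lambda>n. qpoch q (a * d) n * c ^ n)"
  define Y' where "Y' = qegf q (\<lambda>n. qpoch q (q * a * d) n * c ^ n)"
  define F where "F = qegf q (\<lambda>j. asc q j a b c d)"
  define F' where "F' = qegf q (\<lambda>j. asc q j (q * a) b c d)"
  have F: "F = X * Y" unfolding F_def X_def Y_def by (rule qegf_asc[OF nz])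
  have "qegf q (\<lambda>n. qpoch q (c * b) n * (q * a) ^ n) = qdil q X"
    by (rule fps_ext) (simp add: X_def power_mult_distrib)
  then have F': "F' = qdil q X * Y'"
    unfolding F'_def Y'_def qegf_asc[OF nz] by simp
  have Y': "fps_const (1 - a * d) * Y' = Y - fps_const (a * d) * qdil q Y"
  proof (rule fps_ext)
    fix n
    show "fps_nth (fps_const (1 - a * d) * Y') n = fps_nth (Y - fps_const (a * d) * qdil q Y) n"
    proof -
      have "fps_nth (fps_const (1 - a * d) * Y') n
          = (1 - a * d) * qpoch q (q * (a * d)) n * (c ^ n / qpoch q q n)"
        by (simp add: Y'_def mult.assoc)
      also have "\<dots> = fps_nth (Y - fps_const (a * d) * qdil q Y) n"
        unfolding qpoch_shift qpoch_Suc by (simp add: Y_def right_diff_distrib left_diff_distrib mult_ac)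
      finally show ?thesis .
    qed
  qed
  have X: "lin a * X = lin (a * (c * b)) * qdil q X"
    unfolding X_def by (rule q_binomial_series[OF nz])
  have Y: "lin c * Y = lin (c * (a * d)) * qdil q Y"
    unfolding Y_def by (rule q_binomial_series[OF nz])
  (* Over a commutative ring; K, A, B, D, t stand for c, a, b, d and the formal variable,
     and xd, yd for the dilations of x, y. *)
  have alg: "K * t * (1 - A * B) * (xd * (y - A * D * yd))
      = (1 - A * t) * (x * y) - (1 - A * A * B * K * D * t) * (xd * yd)"
    if "(1 - A * t) * x = (1 - A * (K * B) * t) * xd"
       "(1 - K * t) * y = (1 - K * (A * D) * t) * yd"
    for A B K D t x y xd yd :: "'a fps"
    using that by algebra
  have main: "fps_const c * fps_X * (1 - fps_const a * fps_const b)
        * (fps_const (1 - a * d) * F')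
      = lin a * F - lin (a * a * b * c * d) * qdil q F"
    using alg[of "fps_const a" fps_X X "fps_const c" "fps_const b" "qdil q X" Y "fps_const d" "qdil q Y"]
      X Y unfolding F F' qdil_mult
    by (simp add: Y'[unfolded fps_const_mult[symmetric]] mult.left_commute[of _ "qdil q X"]
        fps_const_mult[symmetric] del: fps_const_mult)
  have "fps_const c * fps_X * (1 - fps_const a * fps_const b) * (fps_const (1 - a * d) * F')
      = fps_X * (fps_const (c * (1 - a * b) * (1 - a * d)) * F')"
    by (simp add: fps_const_sub[symmetric] fps_const_mult[symmetric] mult_ac
        del: fps_const_mult fps_const_sub)
  with main have "fps_nth (fps_X * (fps_const (c * (1 - a * b) * (1 - a * d)) * F')) (Suc j)
      = fps_nth (lin a * F - lin (a * a * b * c * d) * qdil q F) (Suc j)"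
    by simp
  then have coeff: "c * (1 - a * b) * (1 - a * d) * fps_nth F' j
      = (1 - q ^ Suc j) * fps_nth F (Suc j) - a * (1 - a * b * c * d * q ^ j) * fps_nth F j"
    unfolding fps_sub_nth lin_mult_nth qdil_nth fps_X_const_mult_nth by (simp add: algebra_simps)
  have nth: "asc q i a b c d = fps_nth F i * qpoch q q i"
    "asc q i (q * a) b c d = fps_nth F' i * qpoch q q i" for i
    using qpoch_q_nonzero[OF nz] by (simp_all add: F_def F'_def)
  have "c * (1 - a * b) * (1 - a * d) * asc q j (q * a) b c d
      = (c * (1 - a * b) * (1 - a * d) * fps_nth F' j) * qpoch q q j"
    by (simp only: nth mult.assoc)
  also have "\<dots> = asc q (Suc j) a b c d - a * (1 - a * b * c * d * q ^ j) * asc q j a b c d"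
    unfolding coeff nth by (simp add: qpoch_Suc algebra_simps)
  finally show ?thesis .
qed

lemma asc_c_zero: "asc q j a b 0 d = a ^ j" if nz: "\<And>n. q ^ Suc n \<noteq> 1"
  for q :: "'a::field"
proof -
  have "asc q j a b 0 d = (\<Sum>k\<in>{j}. qbinom q j k * qpoch q (0 * b) k * a ^ k
     * qpoch q (a * d) (j - k) * 0 ^ (j - k))"
    unfolding asc_def by (rule sum.mono_neutral_right) auto
  then show ?thesis by (simp add: qbinom_def qpoch_q_nonzero[OF nz])
qed

text \<open>
  Multiplied by \<open>c\<close>, this is \<open>asc_shift\<close> times \<open>1 - ac\<close>, once \<open>asc_rec\<close> has been used to remove the
  term with index \<open>j - 1\<close>. For \<open>c = 0\<close>, where one cannot divide by \<open>c\<close>, the sums are plain powers of \<open>a\<close>. The right-hand side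
  is arranged so that it still fits after the weights of \<open>asw\<close> are inserted.
\<close>

lemma asc_contiguous:
  fixes q :: "'a::field"
  assumes nz: "\<And>n. q ^ Suc n \<noteq> 1"
  shows "(1 - a * b) * (1 - a * c) * (1 - a * d) * asc q j (q * a) b c d
    = - a * (1 - b * d * q ^ j) * asc q (Suc j) a b c d
      + (1 - a * b * c * d * q ^ j) * (1 + a\<^sup>2 - a * (b + d) * q ^ j) * asc q j a b c d
      - a * (1 - q ^ j) * (1 - a * b * c * d * q ^ j) * (1 - a * b * c * d * q ^ (j - 1))
          * asc q (j - 1) a b c d"
    (is "?l = ?r")
proof (cases "c = 0")
  case True
  show ?thesis
    by (cases j) (simp_all add: True asc_c_zero[OF nz] algebra_simps power2_eq_square)
next
  case False
  define P Q where "P = a * b * c * d" and "Q = q ^ j"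
  define A0 A1 A2 A' where "A0 = asc q (j - 1) a b c d" and "A1 = asc q j a b c d"
    and "A2 = asc q (Suc j) a b c d" and "A' = asc q j (q * a) b c d"
  (* The term that the three-term recurrence eliminates. *)
  define Z where "Z = (1 - Q) * a * c * (1 - P * q ^ (j - 1)) * A0"
  have Z: "Z = (a + c - a * c * (b + d) * Q) * A1 - A2"
    using asc_rec[OF nz, of j a b c d]
    by (simp add: A0_def A1_def A2_def Z_def P_def Q_def)
  have S: "c * (1 - a * b) * (1 - a * d) * A' = A2 - a * (1 - P * Q) * A1"
    using asc_shift[OF nz, of c a b d j] by (simp add: A1_def A2_def A'_def P_def Q_def)
  have "c * ?r = - a * c * (1 - b * d * Q) * A2
      + c * (1 - P * Q) * (1 + a\<^sup>2 - a * (b + d) * Q) * A1 - (1 - P * Q) * Z"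
    by (simp add: A0_def A1_def A2_def Z_def P_def Q_def algebra_simps)
  also have "\<dots> = (1 - a * c) * (A2 - a * (1 - P * Q) * A1)"
    unfolding Z P_def by (simp add: algebra_simps power2_eq_square)
  also have "\<dots> = c * ?l"
    unfolding S[symmetric] by (simp add: A'_def)
  finally show ?thesis using False by simp
qed

section \<open>Contiguous relation and symmetry of the connection coefficients\<close>

lemma qegf_S2:
  fixes q :: "'a::field"
  assumes nz: "\<And>n. q ^ Suc n \<noteq> 1"
  shows "qegf q (\<lambda>n. S2 q n a b) = qegf q (\<lambda>n. a ^ n) * qegf q (\<lambda>n. b ^ n)"
  unfolding qegf_mult[OF nz] S2_def ..

text \<open>
  The generating function of \<open>S2\<close> is \<open>1 / (at, bt)\<^sub>\<infinity>\<close>.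
\<close>

lemma qegf_S2_equation:
  fixes q :: "'a::field"
  assumes nz: "\<And>n. q ^ Suc n \<noteq> 1"
  defines "S \<equiv> \<lambda>a b. qegf q (\<lambda>n. S2 q n a b)"
  shows "lin a * (lin b * S a b) = qdil q (S a b)"
proof -
  define e where "e = (\<lambda>s. qegf q (\<lambda>n. s ^ n))"
  have e: "lin s * e s = qdil q (e s)" for s
    using q_binomial_series[OF nz, of s 0] by (simp add: e_def)
  have S: "S a b = e a * e b"
    unfolding S_def e_def by (rule qegf_S2[OF nz])
  have "lin a * (lin b * S a b) = (lin a * e a) * (lin b * e b)"
    unfolding S by (simp only: mult_ac)
  then show ?thesis
    unfolding e S qdil_mult .
qed

text \<open>
  With \<open>a + b = 2x\<close> and \<open>ab = 1\<close> this is the recurrence of the continuous \<open>q\<close>-Hermite polynomials.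
\<close>

lemma S2_rec:
  fixes q :: "'a::field"
  assumes nz: "\<And>n. q ^ Suc n \<noteq> 1"
  shows "S2 q (Suc (Suc n)) a b = (a + b) * S2 q (Suc n) a b - a * b * (1 - q ^ Suc n) * S2 q n a b"
    and "S2 q (Suc 0) a b = a + b"
proof -
  define S where "S = qegf q (\<lambda>n. S2 q n a b)"
  have eq: "fps_nth (lin a * (lin b * S)) i = fps_nth (qdil q S) i" for i
    using qegf_S2_equation[OF nz] by (simp add: S_def)
  have nth: "S2 q i a b = fps_nth S i * qpoch q q i" for i
    using qpoch_q_nonzero[OF nz] by (simp add: S_def)
  have "fps_nth S (Suc (Suc n)) * (1 - q ^ Suc (Suc n))
      = (a + b) * fps_nth S (Suc n) - a * b * fps_nth S n"
    using eq[of "Suc (Suc n)"] unfolding lin_mult_nth qdil_nth by (simp add: algebra_simps)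
  then have "fps_nth S (Suc (Suc n)) * (1 - q ^ Suc (Suc n)) * qpoch q q (Suc n)
      = ((a + b) * fps_nth S (Suc n) - a * b * fps_nth S n) * qpoch q q (Suc n)"
    by (rule arg_cong)
  also have "\<dots> = (a + b) * (fps_nth S (Suc n) * qpoch q q (Suc n))
      - a * b * (1 - q ^ Suc n) * (fps_nth S n * qpoch q q n)"
    unfolding qpoch_Suc by (simp add: algebra_simps)
  finally show "S2 q (Suc (Suc n)) a b
      = (a + b) * S2 q (Suc n) a b - a * b * (1 - q ^ Suc n) * S2 q n a b"
    unfolding nth qpoch_Suc[of q q "Suc n"] by (simp add: mult_ac)
  have "fps_nth S 0 = 1" by (simp add: S_def S2_def qbinom_def)
  then show "S2 q (Suc 0) a b = a + b"
    using eq[of "Suc 0"] unfolding lin_mult_nth qdil_nth nth by (simp add: qpoch_Suc algebra_simps)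
qed

lemma S2_commute:
  fixes q :: "'a::field"
  assumes nz: "\<And>n. q ^ Suc n \<noteq> 1"
  shows "S2 q n a b = S2 q n b a"
proof -
  have "qegf q (\<lambda>n. S2 q n a b) = qegf q (\<lambda>n. S2 q n b a)"
    unfolding qegf_S2[OF nz] by (rule mult.commute)
  from arg_cong[OF this, of "\<lambda>f. fps_nth f n"] show ?thesis
    using qpoch_q_nonzero[OF nz] by simp
qed

text \<open>
  The part of the \<open>j\<close>-th summand of \<open>sigma4\<close> that involves \<open>a\<close> or \<open>c\<close>; with it, \<open>sigma4\<close> is a \<open>q\<close>-binomial convolution.
\<close>

definition asw :: "'a::field \<Rightarrow> nat \<Rightarrow> 'a \<Rightarrow> 'a \<Rightarrow> 'a \<Rightarrow> 'a \<Rightarrow> 'a" where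
  "asw q j a b c d = qpoch q (b * d) j / qpoch q (a * b * c * d) j * asc q j a b c d"

lemma sigma4_altdef:
  "sigma4 q n a b c d = (\<Sum>j\<le>n. qbinom q n j * asw q j a b c d * S2 q (n - j) b d)"
  unfolding sigma4_def asw_def asc_def by (simp add: mult_ac)

lemma qegf_sigma4:
  fixes q :: "'a::field"
  assumes nz: "\<And>n. q ^ Suc n \<noteq> 1"
  shows "qegf q (\<lambda>n. sigma4 q n a b c d)
    = qegf q (\<lambda>j. asw q j a b c d) * qegf q (\<lambda>n. S2 q n b d)"
  unfolding qegf_mult[OF nz] sigma4_altdef ..

lemma qpoch_nonzero:
  fixes q :: "'a::field"
  assumes "\<And>n. t * q ^ n \<noteq> 1"
  shows "qpoch q t n \<noteq> 0"
  using assms by (induction n) (auto simp: qpoch_Suc)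

text \<open>
  This is \<open>asc_contiguous\<close> multiplied by \<open>(bd)\<^sub>j / ((abcd)\<^bsub>j+1\<^esub> (q)\<^sub>j)\<close>. The weight at
  \<open>qa\<close> enters through \<open>(1 - abcd) (qabcd)\<^sub>j = (abcd)\<^bsub>j+1\<^esub>\<close>.
\<close>

lemma asw_contiguous:
  fixes q a b c d :: "'a::field"
  assumes nz: "\<And>n. q ^ Suc n \<noteq> 1" and nzP: "\<And>n. a * b * c * d * q ^ n \<noteq> 1"
  defines "W \<equiv> \<lambda>j. asw q j a b c d / qpoch q q j"
  shows "(1 - a * b) * (1 - a * c) * (1 - a * d) * (asw q j (q * a) b c d / qpoch q q j)
    = (1 - a * b * c * d) * (- a * (1 - q ^ Suc j) * W (Suc j)
      + (1 + a\<^sup>2 - a * (b + d) * q ^ j) * W j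
      - (if j = 0 then 0 else a * (1 - b * d * q ^ (j - 1)) * W (j - 1)))"
proof -
  define P where "P = a * b * c * d"
  note P = P_def[symmetric]
  define w where "w = qpoch q (b * d) j / (qpoch q P (Suc j) * qpoch q q j)"
  have q: "qpoch q q i \<noteq> 0" for i by (rule qpoch_q_nonzero[OF nz])
  have p: "qpoch q P i \<noteq> 0" for i using qpoch_nonzero[of P q] nzP by (simp add: P)
  have pf: "1 - P * q ^ i \<noteq> 0" for i using nzP[of i] by (simp add: P)
  have qf: "1 - q ^ Suc i \<noteq> 0" for i using nz[of i] by simp
  have P1: "1 - P \<noteq> 0" using pf[of 0] by simp
  have shift: "qpoch q (q * P) j = qpoch q P (Suc j) / (1 - P)"
    using P1 by (simp add: qpoch_shift[symmetric])
  have A': "asw q j (q * a) b c d / qpoch q q j = (1 - P) * (w * asc q j (q * a) b c d)"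
  proof -
    have "q * a * b * c * d = q * P" by (simp add: P_def mult.assoc)
    then show ?thesis
      unfolding asw_def w_def by (simp only: shift) (simp add: mult_ac)
  qed
  have W1: "(1 - q ^ Suc j) * W (Suc j) = (1 - b * d * q ^ j) * (w * asc q (Suc j) a b c d)"
    using qf[of j] unfolding W_def asw_def P w_def qpoch_Suc[of q q] qpoch_Suc[of q "b * d"]
    by simp
  have W0: "W j = (1 - P * q ^ j) * (w * asc q j a b c d)"
    using pf[of j] unfolding W_def asw_def P w_def qpoch_Suc[of q P] by simp
  have Wm: "(1 - b * d * q ^ (j - 1)) * W (j - 1)
      = (1 - q ^ j) * (1 - P * q ^ j) * (1 - P * q ^ (j - 1)) * (w * asc q (j - 1) a b c d)"
    if "j \<noteq> 0"
  proof -
    from \<open>j \<noteq> 0\<close> obtain i where i: "j = Suc i" by (cases j) auto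
    show ?thesis
      using pf[of "Suc i"] pf[of i] qf[of i] p[of i] q[of i]
      unfolding W_def asw_def P w_def i diff_Suc_1 qpoch_Suc
      by (simp add: divide_simps)
  qed
  have Wm': "(if j = 0 then 0 else a * (1 - b * d * q ^ (j - 1)) * W (j - 1))
      = a * (1 - q ^ j) * (1 - P * q ^ j) * (1 - P * q ^ (j - 1)) * (w * asc q (j - 1) a b c d)"
    using Wm by (simp add: mult.assoc)
  have "(1 - a * b) * (1 - a * c) * (1 - a * d) * (asw q j (q * a) b c d / qpoch q q j)
      = (1 - P) * w * ((1 - a * b) * (1 - a * c) * (1 - a * d) * asc q j (q * a) b c d)"
    unfolding A' by (simp only: mult_ac)
  also have "\<dots> = (1 - P) * (- a * ((1 - b * d * q ^ j) * (w * asc q (Suc j) a b c d))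
      + (1 + a\<^sup>2 - a * (b + d) * q ^ j) * ((1 - P * q ^ j) * (w * asc q j a b c d))
      - a * (1 - q ^ j) * (1 - P * q ^ j) * (1 - P * q ^ (j - 1)) * (w * asc q (j - 1) a b c d))"
  proof -
    have dist: "u * w * (- a * x1 * x2 + y1 * y2 * y3 - z1 * z2 * z3 * z4 * z5)
        = u * (- a * (x1 * (w * x2)) + y2 * (y1 * (w * y3)) - z1 * z2 * z3 * z4 * (w * z5))"
      for u x1 x2 y1 y2 y3 z1 z2 z3 z4 z5 by algebra
    show ?thesis
      unfolding asc_contiguous[OF nz] P by (rule dist)
  qed
  finally show ?thesis
    unfolding Wm' unfolding P W0 W1[symmetric] by (simp add: mult.assoc)
qed

text \<open>
  For the generating functions \<open>W\<close> of \<open>asw\<close> and \<open>S\<close> of \<open>S2\<close>, the previous lemma expresses \<open>W\<close> at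
  \<open>qa\<close> by \<open>W(t)\<close> and \<open>(1 - bt)(1 - dt) W(qt)\<close>. The factors \<open>(1 - bt)(1 - dt)\<close> are exactly those that
  turn \<open>S(t)\<close> into \<open>S(qt)\<close>, so the relation passes to the product \<open>W S\<close>.
\<close>

lemma sigma4_contiguous:
  fixes q a b c d :: "'a::field"
  assumes nz: "\<And>n. q ^ Suc n \<noteq> 1" and nzP: "\<And>n. a * b * c * d * q ^ n \<noteq> 1"
  shows "(1 - a * b) * (1 - a * c) * (1 - a * d) * sigma4 q n (q * a) b c d
    = (1 - a * b * c * d) * ((1 + a\<^sup>2) * sigma4 q n a b c d - a * sigma4 q (Suc n) a b c d
        - a * (1 - q ^ n) * sigma4 q (n - 1) a b c d)"
proof -
  define k where "k = (1 - a * b) * (1 - a * c) * (1 - a * d)"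
  define P where "P = a * b * c * d"
  define S where "S = qegf q (\<lambda>n. S2 q n b d)"
  define W where "W = qegf q (\<lambda>j. asw q j a b c d)"
  define W' where "W' = qegf q (\<lambda>j. asw q j (q * a) b c d)"
  define G where "G = qegf q (\<lambda>n. sigma4 q n a b c d)"
  define G' where "G' = qegf q (\<lambda>n. sigma4 q n (q * a) b c d)"
  have G: "G = W * S" and G': "G' = W' * S"
    unfolding G_def G'_def W_def W'_def S_def by (rule qegf_sigma4[OF nz])+
  have S: "lin b * (lin d * S) = qdil q S"
    unfolding S_def by (rule qegf_S2_equation[OF nz])
  have Xa: "fps_nth ((fps_X - fps_const a) * f) 0 = - a * fps_nth f 0"
    "fps_nth ((fps_X - fps_const a) * f) (Suc n) = fps_nth f n - a * fps_nth f (Suc n)" for f n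
    by (simp_all add: left_diff_distrib)
  have W: "fps_X * (fps_const k * W') = fps_const (1 - P) * ((fps_X - fps_const a) * (lin a * W)
      + fps_const a * (lin b * (lin d * qdil q W)))"
  proof (rule fps_ext)
    fix n
    show "fps_nth (fps_X * (fps_const k * W')) n
      = fps_nth (fps_const (1 - P) * ((fps_X - fps_const a) * (lin a * W)
      + fps_const a * (lin b * (lin d * qdil q W)))) n"
    proof (cases n)
      case 0
      then show ?thesis by (simp add: Xa lin_mult_nth)
    next
      case (Suc j)
      have "k * fps_nth W' j = (1 - P) * (- a * (1 - q ^ Suc j) * fps_nth W (Suc j)
        + (1 + a\<^sup>2 - a * (b + d) * q ^ j) * fps_nth W j
        - (if j = 0 then 0 else a * (1 - b * d * q ^ (j - 1)) * fps_nth W (j - 1)))"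
        using asw_contiguous[OF nz nzP, of j] by (simp add: W_def W'_def k_def P_def)
      then show ?thesis
        unfolding Suc fps_X_const_mult_nth fps_mult_left_const_nth fps_add_nth
        by (cases j) (simp_all add: lin_mult_nth Xa algebra_simps power2_eq_square)
    qed
  qed
  have "fps_X * (fps_const k * G') = fps_X * (fps_const k * W') * S"
    by (simp only: G' mult_ac)
  also have "\<dots> = fps_const (1 - P) * ((fps_X - fps_const a) * (lin a * (W * S))
      + fps_const a * (qdil q W * (lin b * (lin d * S))))"
    unfolding W by (simp only: distrib_right distrib_left mult_ac)
  also have "\<dots> = fps_const (1 - P) * ((fps_X - fps_const a) * (lin a * G) + fps_const a * qdil q G)"
    unfolding S G qdil_mult ..
  finally have "k * fps_nth G' n = (1 - P) * ((fps_nth (lin a * G) n - a * fps_nth (lin a * G) (Suc n))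
      + a * (q ^ Suc n * fps_nth G (Suc n)))"
    by (metis (no_types, lifting) Xa(2) fps_X_const_mult_nth fps_add_nth fps_mult_left_const_nth qdil_nth)
  also have "\<dots> = (1 - P) * ((1 + a\<^sup>2) * fps_nth G n - a * ((1 - q ^ Suc n) * fps_nth G (Suc n))
      - a * (if n = 0 then 0 else fps_nth G (n - 1)))"
    by (cases n) (simp_all add: lin_mult_nth algebra_simps power2_eq_square)
  finally have main: "k * fps_nth G' n * qpoch q q n
     = (1 - P) * ((1 + a\<^sup>2) * fps_nth G n - a * ((1 - q ^ Suc n) * fps_nth G (Suc n))
      - a * (if n = 0 then 0 else fps_nth G (n - 1))) * qpoch q q n"
    by (rule arg_cong)
  have nth: "sigma4 q i a b c d = fps_nth G i * qpoch q q i"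
    "sigma4 q i (q * a) b c d = fps_nth G' i * qpoch q q i" for i
    using qpoch_q_nonzero[OF nz] by (simp_all add: G_def G'_def)
  show ?thesis
    unfolding nth k_def[symmetric] P_def[symmetric] mult.assoc[symmetric] main
    by (cases n) (simp_all add: qpoch_Suc algebra_simps)
qed

lemma sigma4_0 [simp]: "sigma4 q 0 a b c d = 1"
  by (simp add: sigma4_def qbinom_def S2_def)

lemma sigma4_swap_13:
  fixes q :: "'a::field"
  assumes nz: "\<And>n. q ^ Suc n \<noteq> 1"
  shows "sigma4 q n a b c d = sigma4 q n c b a d"
  unfolding sigma4_altdef asw_def asc_swap_13[OF nz, of _ a] by (simp add: mult_ac)

lemma sigma4_swap_24:
  fixes q :: "'a::field"
  assumes nz: "\<And>n. q ^ Suc n \<noteq> 1"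
  shows "sigma4 q n a b c d = sigma4 q n a d c b"
  unfolding sigma4_altdef asw_def asc_swap_24[OF nz, of _ a b] S2_commute[OF nz, of _ b]
  by (simp add: mult_ac)

text \<open>
  For \<open>a = 0\<close> the generating function is \<open>(bcdt)\<^sub>\<infinity> / (bt, ct, dt)\<^sub>\<infinity>\<close>; its symmetry serves as the case \<open>a = 0\<close>
  of the symmetry proof, where the contiguous relation does not determine the next coefficient.
\<close>

lemma qegf_sigma4_a_zero:
  fixes q b c d :: "'a::field"
  assumes nz: "\<And>n. q ^ Suc n \<noteq> 1"
  defines "F \<equiv> qegf q (\<lambda>n. sigma4 q n 0 b c d)"
  shows "lin b * (lin c * (lin d * F)) = lin (b * c * d) * qdil q F"
proof -
  define S where "S = qegf q (\<lambda>n. S2 q n b d)"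
  define W where "W = qegf q (\<lambda>n. qpoch q (b * d) n * c ^ n)"
  have "asw q j 0 b c d = qpoch q (b * d) j * c ^ j" for j
    using asc_c_zero[OF nz, of j c b d] asc_swap_13[OF nz, of j 0 b c d] by (simp add: asw_def)
  then have F: "F = W * S"
    unfolding F_def qegf_sigma4[OF nz] by (simp add: W_def S_def)
  have W: "lin c * W = lin (c * (b * d)) * qdil q W"
    unfolding W_def by (rule q_binomial_series[OF nz])
  have S: "lin b * (lin d * S) = qdil q S"
    unfolding S_def by (rule qegf_S2_equation[OF nz])
  have "lin b * (lin c * (lin d * F)) = (lin c * W) * (lin b * (lin d * S))"
    unfolding F by (simp only: mult_ac)
  also have "\<dots> = lin (b * c * d) * qdil q F"
    unfolding F W S qdil_mult by (simp only: mult_ac)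
  finally show ?thesis .
qed

lemma sigma4_a_zero_swap_23:
  fixes q b c d :: "'a::field"
  assumes nz: "\<And>n. q ^ Suc n \<noteq> 1"
  shows "sigma4 q n 0 b c d = sigma4 q n 0 c b d"
proof -
  define F where "F = (\<lambda>b c. qegf q (\<lambda>n. sigma4 q n 0 b c d))"
  have "F b c = F c b"
  proof (rule qdil_equation_unique[OF nz])
    show "(lin b * lin c * lin d) * F b c = lin (b * c * d) * qdil q (F b c)"
      using qegf_sigma4_a_zero[OF nz] by (simp add: F_def mult.assoc)
    show "(lin b * lin c * lin d) * F c b = lin (b * c * d) * qdil q (F c b)"
      using qegf_sigma4_a_zero[OF nz, of c b d] by (simp add: F_def mult.left_commute mult.commute mult.assoc)
  qed (simp_all add: F_def)
  from arg_cong[OF this, of "\<lambda>f. fps_nth f n"] show ?thesis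
    using qpoch_q_nonzero[OF nz] by (simp add: F_def)
qed

text \<open>
  By induction on \<open>n\<close>, for all \<open>a\<close> at once since the contiguous relation refers to \<open>qa\<close>: it gives
  \<open>a \<sigma>\<^bsub>n+1\<^esub>\<close> in terms of \<open>\<sigma>\<^sub>n\<close> and \<open>\<sigma>\<^bsub>n-1\<^esub>\<close>, with coefficients symmetric in \<open>b, c, d\<close>.
\<close>

lemma sigma4_swap_23:
  fixes q a b c d :: "'a::field"
  assumes nz: "\<And>n. q ^ Suc n \<noteq> 1" and nzP: "\<And>n. a * b * c * d * q ^ n \<noteq> 1"
  shows "sigma4 q n a b c d = sigma4 q n a c b d"
  using nzP
proof (induction n arbitrary: a rule: less_induct)
  case (less n)
  consider "n = 0" | "a = 0" | m where "n = Suc m" "a \<noteq> 0"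
    by (cases n) auto
  then show ?case
  proof cases
    case 3
    have shifted: "q * a * b * c * d * q ^ i \<noteq> 1" for i
      using less.prems[of "Suc i"] by (simp add: mult_ac)
    have prems': "a * c * b * d * q ^ i \<noteq> 1" for i
      using less.prems[of i] by (simp add: mult_ac)
    have P1: "1 - a * b * c * d \<noteq> 0"
      using less.prems[of 0] by simp
    have IH: "sigma4 q m a b c d = sigma4 q m a c b d"
      "sigma4 q (m - 1) a b c d = sigma4 q (m - 1) a c b d"
      "sigma4 q m (q * a) b c d = sigma4 q m (q * a) c b d"
      using 3 shifted less.prems by (auto intro!: less.IH)
    have step: "(1 - a * b * c * d) * (a * sigma4 q (Suc m) a b c d)
      = (1 - a * b * c * d) * ((1 + a\<^sup>2) * sigma4 q m a b c d - a * (1 - q ^ m) * sigma4 q (m - 1) a b c d)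
        - (1 - a * b) * (1 - a * c) * (1 - a * d) * sigma4 q m (q * a) b c d"
      if "\<And>i. a * b * c * d * q ^ i \<noteq> 1" for b c
      unfolding sigma4_contiguous[OF nz that] by (simp add: right_diff_distrib)
    have "(1 - a * b * c * d) * (a * sigma4 q n a b c d) = (1 - a * c * b * d) * (a * sigma4 q n a c b d)"
      unfolding 3(1) step[OF less.prems] step[OF prems'] IH by (simp add: mult_ac)
    then have "(1 - a * b * c * d) * (a * sigma4 q n a b c d) = (1 - a * b * c * d) * (a * sigma4 q n a c b d)"
      by (simp add: mult_ac)
    then show ?thesis using P1 3 by simp
  qed (use sigma4_a_zero_swap_23[OF nz] in auto)
qed

section \<open>Geometric majorants and infinite \<open>q\<close>-products\<close>

lemma summable_poly_geometric:
  fixes r :: real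
  assumes "0 \<le> r" "r < 1"
  shows "summable (\<lambda>n. real (Suc n) ^ k * r ^ n)"
proof -
  (* The ratio of consecutive terms tends to r, hence is eventually below c. *)
  define c where "c = (1 + r) / 2"
  have c: "r < c" "c < 1" using assms by (auto simp: c_def)
  have "(\<lambda>n. (1 + inverse (real (Suc n))) ^ k * r) \<longlonglongrightarrow> (1 + 0) ^ k * r"
    by (intro tendsto_intros LIMSEQ_inverse_real_of_nat)
  then have "eventually (\<lambda>n. (1 + inverse (real (Suc n))) ^ k * r < c) sequentially"
    using c by (intro order_tendstoD(2)[where y = "(1 + 0) ^ k * r"]) auto
  then obtain N where N: "\<And>n. n \<ge> N \<Longrightarrow> (1 + inverse (real (Suc n))) ^ k * r < c"
    by (auto simp: eventually_sequentially)
  show ?thesis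
  proof (rule summable_ratio_test[OF c(2), of N])
    fix n assume "n \<ge> N"
    have "real (Suc (Suc n)) = real (Suc n) * (1 + inverse (real (Suc n)))"
      by (simp add: field_simps)
    then have "real (Suc (Suc n)) ^ k * r ^ Suc n
        = ((1 + inverse (real (Suc n))) ^ k * r) * (real (Suc n) ^ k * r ^ n)"
      by (simp add: power_mult_distrib)
    also have "\<dots> \<le> c * (real (Suc n) ^ k * r ^ n)"
      using N[OF \<open>n \<ge> N\<close>] assms by (intro mult_right_mono) auto
    finally show "norm (real (Suc (Suc n)) ^ k * r ^ Suc n) \<le> c * norm (real (Suc n) ^ k * r ^ n)"
      using assms by simp
  qed
qed

lemma abs_convergent_prod_qpoch:
  fixes q a :: "'a::{real_normed_field}"
  assumes "norm q < 1"
  shows "abs_convergent_prod (\<lambda>j. 1 - a * q ^ j)"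
proof (rule summable_imp_abs_convergent_prod)
  show "summable (\<lambda>i. norm (1 - a * q ^ i - 1))"
    using assms by (simp add: norm_mult norm_power summable_mult summable_geometric)
qed

lemma qpoch_tendsto_qpoch_inf:
  fixes q a :: "'a::{real_normed_field,banach}"
  assumes "norm q < 1"
  shows "(\<lambda>n. qpoch q a n) \<longlonglongrightarrow> qpoch_inf q a"
proof -
  have "convergent_prod (\<lambda>j. 1 - a * q ^ j)"
    by (rule abs_convergent_prod_imp_convergent_prod[OF abs_convergent_prod_qpoch[OF assms]])
  then have "(\<lambda>n. \<Prod>j\<le>n. 1 - a * q ^ j) \<longlonglongrightarrow> qpoch_inf q a"
    unfolding qpoch_inf_def by (rule convergent_prod_LIMSEQ)
  then have "(\<lambda>n. qpoch q a (Suc n)) \<longlonglongrightarrow> qpoch_inf q a"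
    by (simp add: qpoch_def lessThan_Suc_atMost)
  then show ?thesis by (simp only: filterlim_sequentially_Suc)
qed

lemma qpoch_inf_nonzero:
  fixes q a :: "'a::{real_normed_field,banach}"
  assumes "norm q < 1" "norm a < 1"
  shows "qpoch_inf q a \<noteq> 0"
  unfolding qpoch_inf_def
proof (rule prodinf_nonzero)
  show "convergent_prod (\<lambda>j. 1 - a * q ^ j)"
    by (rule abs_convergent_prod_imp_convergent_prod[OF abs_convergent_prod_qpoch[OF assms(1)]])
  show "1 - a * q ^ j \<noteq> 0" for j
  proof
    assume "1 - a * q ^ j = 0"
    then have "norm a * norm q ^ j = 1" by (simp add: norm_mult[symmetric] norm_power[symmetric])
    moreover have "norm a * norm q ^ j \<le> norm a * 1"
      using assms by (intro mult_left_mono power_le_one) auto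
    ultimately show False using assms by simp
  qed
qed

section \<open>Growth of the coefficients and of the \<open>q\<close>-Hermite polynomials\<close>

lemma norm_sum_atMost_le:
  fixes f :: "nat \<Rightarrow> 'a::real_normed_vector"
  assumes "\<And>k. k \<le> n \<Longrightarrow> norm (f k) \<le> K"
  shows "norm (\<Sum>k\<le>n. f k) \<le> real (Suc n) * K"
proof -
  have "norm (\<Sum>k\<le>n. f k) \<le> (\<Sum>k\<le>n. norm (f k))"
    by (rule norm_sum)
  also have "\<dots> \<le> real (card {..n}) * K"
    using assms by (intro sum_bounded_above) auto
  finally show ?thesis by simp
qed

lemma norm_mult_less_1:
  fixes u v :: complex
  assumes "norm u < 1" "norm v < 1"
  shows "norm (u * v) < 1"
proof -
  have "norm u * norm v \<le> 1 * norm v" using assms by (intro mult_right_mono) auto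
  then show ?thesis using assms by (simp add: norm_mult)
qed

lemma qpoch_inf_0 [simp]: "qpoch_inf q 0 = 1"
  by (simp add: qpoch_inf_def)

context
  fixes q :: complex
  assumes q: "norm q < 1"
begin

lemma q_power_ne_1: "q ^ Suc n \<noteq> 1"
proof
  assume "q ^ Suc n = 1"
  then have "norm q ^ Suc n = 1" by (metis norm_one norm_power)
  moreover have "norm q * norm q ^ n \<le> norm q * 1"
    using q by (intro mult_left_mono power_le_one) auto
  ultimately show False using q by simp
qed

lemma mult_q_power_ne_1:
  assumes "norm t < 1"
  shows "t * q ^ n \<noteq> 1"
proof
  assume "t * q ^ n = 1"
  then have "norm t * norm q ^ n = 1" by (metis norm_mult norm_one norm_power)
  moreover have "norm t * norm q ^ n \<le> norm t * 1"
    using q by (intro mult_left_mono power_le_one) auto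
  ultimately show False using assms by simp
qed

text \<open>
  The products are dominated by \<open>\<Prod>j. 1 + \<bar>q\<bar>^j\<close>.
\<close>

lemma qpoch_upper_bound:
  obtains M where "M > 0" "\<And>t n. norm t \<le> 1 \<Longrightarrow> norm (qpoch q t n) \<le> M"
proof -
  have "convergent (\<lambda>n. qpoch (norm q) (-1) n)"
    using qpoch_tendsto_qpoch_inf[of "norm q" "-1"] q by (auto intro: convergentI)
  then have "Bseq (\<lambda>n. qpoch (norm q) (-1) n)"
    by (rule convergent_imp_Bseq)
  then obtain M where M: "M > 0" "\<And>n. norm (qpoch (norm q) (-1) n) \<le> M"
    unfolding Bseq_def by auto
  have "norm (qpoch q t n) \<le> M" if "norm t \<le> 1" for t n
  proof -
    have "norm (1 - t * q ^ j) \<le> 1 - (-1) * norm q ^ j" for j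
    proof -
      have "norm (1 - t * q ^ j) \<le> norm (1::complex) + norm (t * q ^ j)"
        by (rule norm_triangle_ineq4)
      also have "norm (t * q ^ j) \<le> 1 * norm q ^ j"
        unfolding norm_mult norm_power using that by (intro mult_right_mono) auto
      finally show ?thesis by simp
    qed
    then have "norm (qpoch q t n) \<le> qpoch (norm q) (-1) n"
      unfolding qpoch_def prod_norm[symmetric] by (intro prod_mono) auto
    then show ?thesis using M(2)[of n] by simp
  qed
  with M(1) show ?thesis by (rule that)
qed

text \<open>
  The moduli dominate the partial products of \<open>\<Prod>j. 1 - s \<bar>q\<bar>^j\<close>, whose reciprocals converge and are
  therefore bounded.
\<close>

lemma qpoch_lower_bound:
  assumes "0 \<le> s" "s < 1"
  obtains m where "m > 0" "\<And>t n. norm t \<le> s \<Longrightarrow> m \<le> norm (qpoch q t n)"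
proof -
  have fac: "0 < 1 - s * norm q ^ j" for j
  proof -
    have "s * norm q ^ j \<le> s * 1"
      using assms q by (intro mult_left_mono power_le_one) auto
    then show ?thesis using assms by simp
  qed
  have pos: "0 < qpoch (norm q) s n" for n
    unfolding qpoch_def using fac by (intro prod_pos) auto
  have "qpoch_inf (norm q) s \<noteq> 0"
    using assms q by (intro qpoch_inf_nonzero) auto
  then have "convergent (\<lambda>n. inverse (qpoch (norm q) s n))"
    using qpoch_tendsto_qpoch_inf[of "norm q" s] q by (auto intro!: convergentI tendsto_inverse)
  then have "Bseq (\<lambda>n. inverse (qpoch (norm q) s n))"
    by (rule convergent_imp_Bseq)
  then obtain K where K: "K > 0" "\<And>n. norm (inverse (qpoch (norm q) s n)) \<le> K"
    unfolding Bseq_def by auto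
  have "inverse K \<le> norm (qpoch q t n)" if "norm t \<le> s" for t n
  proof -
    have "1 - s * norm q ^ j \<le> norm (1 - t * q ^ j)" for j
    proof -
      have "norm (t * q ^ j) \<le> s * norm q ^ j"
        unfolding norm_mult norm_power using that by (intro mult_right_mono) auto
      then show ?thesis
        using norm_triangle_ineq2[of "1::complex" "t * q ^ j"] by simp
    qed
    then have "qpoch (norm q) s n \<le> norm (qpoch q t n)"
      unfolding qpoch_def prod_norm[symmetric] using fac by (intro prod_mono) (auto simp: less_imp_le)
    moreover have "inverse K \<le> qpoch (norm q) s n"
      using K(2)[of n] K(1) pos[of n] by (simp add: field_simps)
    ultimately show ?thesis by simp
  qed
  with K(1) show ?thesis by (intro that[of "inverse K"]) auto
qed

lemma qbinom_bound:
  obtains C where "C > 0" "\<And>n k. norm (qbinom q n k) \<le> C"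
proof -
  obtain M where M: "M > 0" "\<And>t n. norm t \<le> 1 \<Longrightarrow> norm (qpoch q t n) \<le> M"
    using qpoch_upper_bound by blast
  obtain m where m: "m > 0" "\<And>t n. norm t \<le> norm q \<Longrightarrow> m \<le> norm (qpoch q t n)"
    using qpoch_lower_bound[of "norm q"] q by auto
  have "norm (qbinom q n k) \<le> M / (m * m)" for n k
  proof (cases "k \<le> n")
    case True
    then show ?thesis
      unfolding qbinom_def norm_divide norm_mult if_P[OF True]
      using M m q by (intro frac_le mult_mono) (auto intro: less_imp_le)
  qed (use M m in \<open>auto simp: qbinom_def\<close>)
  then show ?thesis using M(1) m(1) by (intro that[of "M / (m * m)"]) auto
qed

lemma S2_bound:
  obtains C where "C > 0"
    "\<And>a b r n. norm a \<le> r \<Longrightarrow> norm b \<le> r \<Longrightarrow> norm (S2 q n a b) \<le> real (Suc n) * (C * r ^ n)"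
proof -
  obtain C where C: "C > 0" "\<And>n k. norm (qbinom q n k) \<le> C"
    using qbinom_bound by blast
  have "norm (S2 q n a b) \<le> real (Suc n) * (C * r ^ n)"
    if r: "norm a \<le> r" "norm b \<le> r" for a b r n
    unfolding S2_def
  proof (rule norm_sum_atMost_le)
    fix k assume k: "k \<le> n"
    have "0 \<le> r" using r(1) norm_ge_zero[of a] by linarith
    then have "norm (qbinom q n k * a ^ k * b ^ (n - k)) \<le> C * r ^ k * r ^ (n - k)"
      unfolding norm_mult norm_power
      using C r by (intro mult_mono power_mono) auto
    also have "\<dots> = C * r ^ n"
      using k by (simp add: mult.assoc flip: power_add)
    finally show "norm (qbinom q n k * a ^ k * b ^ (n - k)) \<le> C * r ^ n" .
  qed
  with C(1) show ?thesis by (rule that)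
qed

text \<open>
  The \<open>q\<close>-factorials and \<open>q\<close>-binomial coefficients are bounded, those in denominators away from \<open>0\<close>, and the powers
  of the parameters in each summand have total degree \<open>n\<close>. Each of the three nested sums contributes a factor \<open>n + 1\<close>.
\<close>

lemma sigma4_bound:
  assumes r: "0 \<le> r" "r < 1"
  obtains C where "C > 0" "\<And>a b c d n. norm a \<le> r \<Longrightarrow> norm b \<le> r \<Longrightarrow> norm c \<le> r \<Longrightarrow> norm d \<le> r
    \<Longrightarrow> norm (sigma4 q n a b c d / qpoch q q n) \<le> C * (real (Suc n) ^ 3 * r ^ n)"
proof -
  obtain M where M: "M > 0" "\<And>t n. norm t \<le> 1 \<Longrightarrow> norm (qpoch q t n) \<le> M"
    using qpoch_upper_bound by blast
  obtain m where m: "m > 0" "\<And>t n. norm t \<le> r \<Longrightarrow> m \<le> norm (qpoch q t n)"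
    using qpoch_lower_bound[OF r] by blast
  obtain m' where m': "m' > 0" "\<And>t n. norm t \<le> norm q \<Longrightarrow> m' \<le> norm (qpoch q t n)"
    using qpoch_lower_bound[of "norm q"] q by auto
  obtain B where B: "B > 0" "\<And>n k. norm (qbinom q n k) \<le> B"
    using qbinom_bound by blast
  obtain C where C: "C > 0" "\<And>a b r n. norm a \<le> r \<Longrightarrow> norm b \<le> r
      \<Longrightarrow> norm (S2 q n a b) \<le> real (Suc n) * (C * r ^ n)"
    using S2_bound by blast
  define D where "D = B * (M / m) * C * (B * M * M)"
  have D: "D > 0" using B M m C by (simp add: D_def)
  have "norm (sigma4 q n a b c d / qpoch q q n) \<le> D / m' * (real (Suc n) ^ 3 * r ^ n)"
    if abcd: "norm a \<le> r" "norm b \<le> r" "norm c \<le> r" "norm d \<le> r" for a b c d n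
  proof -
    have prod: "norm (u * v) \<le> r" if "norm u \<le> r" "norm v \<le> r" for u v :: complex
    proof -
      have "norm (u * v) \<le> r * 1"
        unfolding norm_mult using that r by (intro mult_mono) auto
      then show ?thesis by simp
    qed
    have M': "norm (qpoch q (u * v) i) \<le> M" if "norm u \<le> r" "norm v \<le> r" for u v i
      using prod[OF that] r by (intro M(2)) simp
    have asc: "norm (asc q j a b c d) \<le> real (Suc j) * (B * M * M * r ^ j)" for j
      unfolding asc_def
    proof (rule norm_sum_atMost_le)
      fix k assume k: "k \<le> j"
      have "norm (qbinom q j k * qpoch q (c * b) k * a ^ k * qpoch q (a * d) (j - k) * c ^ (j - k))
          \<le> B * M * r ^ k * M * r ^ (j - k)"
        unfolding norm_mult norm_power
        using B M' M(1) abcd r by (intro mult_mono power_mono) auto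
      also have "\<dots> = B * M * M * (r ^ k * r ^ (j - k))"
        by (simp add: mult_ac)
      also have "r ^ k * r ^ (j - k) = r ^ j"
        using k by (simp flip: power_add)
      finally show "norm (qbinom q j k * qpoch q (c * b) k * a ^ k * qpoch q (a * d) (j - k) * c ^ (j - k))
          \<le> B * M * M * r ^ j" .
    qed
    have "norm (sigma4 q n a b c d) \<le> real (Suc n) * (D * (real (Suc n) ^ 2 * r ^ n))"
      unfolding sigma4_altdef
    proof (rule norm_sum_atMost_le)
      fix j assume j: "j \<le> n"
      have "norm (qpoch q (b * d) j / qpoch q (a * b * c * d) j) \<le> M / m"
        unfolding norm_divide using M' m M(1) abcd prod by (intro frac_le) auto
      then have asw: "norm (asw q j a b c d) \<le> M / m * (real (Suc n) * (B * M * M * r ^ j))"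
        unfolding asw_def norm_mult
      proof (rule mult_mono)
        have "real (Suc j) * (B * M * M * r ^ j) \<le> real (Suc n) * (B * M * M * r ^ j)"
          using j B M r by (intro mult_right_mono) auto
        then show "norm (asc q j a b c d) \<le> real (Suc n) * (B * M * M * r ^ j)"
          using asc[of j] by linarith
      qed (use M m in auto)
      have S2: "norm (S2 q (n - j) b d) \<le> real (Suc n) * (C * r ^ (n - j))"
      proof -
        have "real (Suc (n - j)) * (C * r ^ (n - j)) \<le> real (Suc n) * (C * r ^ (n - j))"
          using C r by (intro mult_right_mono) auto
        then show ?thesis using C(2)[OF abcd(2,4), of "n - j"] by linarith
      qed
      have "norm (qbinom q n j * asw q j a b c d * S2 q (n - j) b d)
          \<le> B * (M / m * (real (Suc n) * (B * M * M * r ^ j))) * (real (Suc n) * (C * r ^ (n - j)))"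
        unfolding norm_mult using B asw S2 M m r by (intro mult_mono) auto
      also have "\<dots> = D * (real (Suc n) ^ 2 * (r ^ j * r ^ (n - j)))"
        by (simp add: D_def power2_eq_square mult_ac)
      also have "r ^ j * r ^ (n - j) = r ^ n"
        using j by (simp flip: power_add)
      finally show "norm (qbinom q n j * asw q j a b c d * S2 q (n - j) b d)
          \<le> D * (real (Suc n) ^ 2 * r ^ n)" .
    qed
    also have "\<dots> = D * (real (Suc n) ^ 3 * r ^ n)"
      by (simp add: power2_eq_square power3_eq_cube mult_ac)
    finally have "norm (sigma4 q n a b c d) / norm (qpoch q q n) \<le> D * (real (Suc n) ^ 3 * r ^ n) / m'"
      using m' D r by (intro frac_le) auto
    then show ?thesis by (simp add: norm_divide)
  qed
  then show ?thesis using D m'(1) by (intro that[of "D / m'"]) auto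
qed

lemma qpoch_inf_shift: "(1 - a) * qpoch_inf q (q * a) = qpoch_inf q a"
proof -
  have "(\<lambda>n. qpoch q a (Suc n)) \<longlonglongrightarrow> (1 - a) * qpoch_inf q (q * a)"
    unfolding qpoch_shift[symmetric] by (intro tendsto_intros qpoch_tendsto_qpoch_inf q)
  moreover have "(\<lambda>n. qpoch q a (Suc n)) \<longlonglongrightarrow> qpoch_inf q a"
    unfolding filterlim_sequentially_Suc by (rule qpoch_tendsto_qpoch_inf[OF q])
  ultimately show ?thesis by (rule LIMSEQ_unique)
qed

text \<open>
  The value is \<open>(a)\<^sub>\<infinity> / (a)\<^sub>N\<close>, and \<open>(a)\<^sub>N\<close> tends to \<open>(a)\<^sub>\<infinity> \<noteq> 0\<close>.
\<close>

lemma qpoch_inf_tendsto_1: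
  assumes "norm a < 1"
  shows "(\<lambda>N. qpoch_inf q (q ^ N * a)) \<longlonglongrightarrow> 1"
proof -
  have split: "qpoch_inf q a = qpoch q a N * qpoch_inf q (q ^ N * a)" for N
  proof (induction N)
    case (Suc N)
    have "qpoch_inf q (q ^ N * a) = (1 - q ^ N * a) * qpoch_inf q (q ^ Suc N * a)"
      using qpoch_inf_shift[of "q ^ N * a"] by (simp add: mult_ac)
    then show ?case using Suc by (simp add: qpoch_Suc mult_ac)
  qed simp
  have nz: "qpoch_inf q a \<noteq> 0" by (rule qpoch_inf_nonzero[OF q assms])
  have "(\<lambda>N. qpoch_inf q a / qpoch q a N) \<longlonglongrightarrow> qpoch_inf q a / qpoch_inf q a"
    by (intro tendsto_intros qpoch_tendsto_qpoch_inf q nz)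
  moreover have "qpoch_inf q a / qpoch q a N = qpoch_inf q (q ^ N * a)" for N
    using split[of N] nz by (auto simp: field_simps)
  ultimately show ?thesis using nz by simp
qed

end

lemma of_real_qpoch:
  "of_real (qpoch q a n) = qpoch (of_real q :: 'a::{real_algebra_1,comm_ring_1}) (of_real a) n"
  by (simp add: qpoch_def)

text \<open>
  With \<open>x = cos \<theta>\<close> the point \<open>z\<close> is \<open>e^(i\<theta>)\<close>.
\<close>

lemma q_hermite_eq_S2:
  fixes q x :: real
  assumes q: "\<bar>q\<bar> < 1" and x: "\<bar>x\<bar> \<le> 1"
  defines "z \<equiv> Complex x (sqrt (1 - x\<^sup>2))"
  shows "complex_of_real (q_hermite q n x) = S2 (of_real q) n z (cnj z)"
proof -
  have nz: "complex_of_real q ^ Suc n \<noteq> 1" for n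
    using q by (intro q_power_ne_1) simp
  have "x\<^sup>2 \<le> 1" using x by (simp add: abs_square_le_1)
  then have zz: "z * cnj z = 1"
    unfolding complex_mult_cnj by (simp add: z_def)
  have zpz: "z + cnj z = 2 * of_real x"
    by (simp add: complex_add_cnj z_def)
  show ?thesis
  proof (induction n rule: induct_nat_012)
    case (ge2 n)
    then show ?case
      unfolding S2_rec(1)[OF nz] zpz zz by simp
  next
    case 1
    then show ?case using S2_rec(2)[OF nz] zpz by simp
  qed (simp add: S2_def qbinom_def)
qed

lemma q_hermite_bound:
  fixes q x :: real
  assumes q: "\<bar>q\<bar> < 1" and x: "\<bar>x\<bar> \<le> 1"
  obtains C where "C > 0" "\<And>n. norm (complex_of_real (q_hermite q n x)) \<le> C * real (Suc n)"
proof -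
  define z where "z = Complex x (sqrt (1 - x\<^sup>2))"
  have "x\<^sup>2 \<le> 1" using x by (simp add: abs_square_le_1)
  then have z: "norm z = 1" by (simp add: z_def cmod_def)
  obtain C where "C > 0" and C: "\<And>a b r n. norm a \<le> r \<Longrightarrow> norm b \<le> r
      \<Longrightarrow> norm (S2 (complex_of_real q) n a b) \<le> real (Suc n) * (C * r ^ n)"
    using S2_bound[of "complex_of_real q"] q by auto
  have "norm (complex_of_real (q_hermite q n x)) \<le> C * real (Suc n)" for n
    unfolding q_hermite_eq_S2[OF q x] z_def[symmetric]
    using C[of z 1 "cnj z" n] z by (simp add: mult_ac)
  with \<open>C > 0\<close> show ?thesis by (rule that)
qed

section \<open>Symmetric functions of four variables\<close>

text \<open>
  The three transpositions \<open>(1 3)\<close>, \<open>(2 4)\<close>, \<open>(2 3)\<close> generate all permutations of the four positions.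
\<close>

lemma symmetric_4_of_swaps:
  assumes swap_13: "\<And>a b c d. {a, b, c, d} \<subseteq> D \<Longrightarrow> f a b c d = f c b a d"
    and swap_24: "\<And>a b c d. {a, b, c, d} \<subseteq> D \<Longrightarrow> f a b c d = f a d c b"
    and swap_23: "\<And>a b c d. {a, b, c, d} \<subseteq> D \<Longrightarrow> f a b c d = f a c b d"
    and D: "{a, b, c, d} \<subseteq> D"
    and eq: "mset [a', b', c', d'] = mset [a, b, c, d]"
  shows "f a' b' c' d' = f a b c d"
proof -
  have s12: "f a b c d = f b a c d" if "{a, b, c, d} \<subseteq> D" for a b c d
    using swap_13[of a b c d] swap_23[of c b a d] swap_13[of c a b d] that by simp
  have s34: "f a b c d = f a b d c" if "{a, b, c, d} \<subseteq> D" for a b c d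
    using swap_24[of a b c d] swap_23[of a d c b] swap_24[of a c d b] that by simp
  have perm2: "f a b x y = f a b u v" if "mset [x, y] = mset [u, v]" "{a, b, u, v} \<subseteq> D" for a b x y u v
  proof -
    have "x \<in> set [u, v]" using mset_eq_setD[OF that(1)] by auto
    then show ?thesis using that s34[of a b u v] by auto
  qed
  have swap_mset: "add_mset v (add_mset u M) = add_mset u (add_mset v M)" for u v :: 'a and M
    by (rule add_mset_commute)
  have perm3: "f a x y z = f a u v w" if eq: "mset [x, y, z] = mset [u, v, w]" and uvw: "{a, u, v, w} \<subseteq> D"
    for a x y z u v w
  proof -
    have "x \<in> set [u, v, w]" using mset_eq_setD[OF eq] by auto
    then consider "x = u" | "x = v" | "x = w" by auto
    then show ?thesis
    proof cases
      case 1
      then have "mset [y, z] = mset [v, w]" using eq by simp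
      then show ?thesis using 1 perm2[of y z v w a u] uvw by simp
    next
      case 2
      have "add_mset v (mset [y, z]) = add_mset v (mset [u, w])"
        using eq 2 swap_mset[of u v "{#w#}"] by simp
      then have "mset [y, z] = mset [u, w]" by simp
      then have "f a v y z = f a v u w" using uvw by (intro perm2) auto
      also have "f a v u w = f a u v w" using uvw by (intro swap_23) auto
      finally show ?thesis using 2 by simp
    next
      case 3
      have "add_mset w (mset [y, z]) = add_mset w (mset [u, v])"
        using eq 3 swap_mset[of v w "{#}"] swap_mset[of u w "{#v#}"] by simp
      then have "mset [y, z] = mset [u, v]" by simp
      then have "f a w y z = f a w u v" using uvw by (intro perm2) auto
      also have "f a w u v = f a u w v" using uvw by (intro swap_23) auto
      also have "f a u w v = f a u v w" using uvw by (intro s34) auto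
      finally show ?thesis using 3 by simp
    qed
  qed
  have "a' \<in> set [a, b, c, d]" using mset_eq_setD[OF eq] by auto
  then consider "a' = a" | "a' = b" | "a' = c" | "a' = d" by auto
  then show ?thesis
  proof cases
    case 1
    then have "mset [b', c', d'] = mset [b, c, d]" using eq by simp
    then show ?thesis using 1 D by (auto intro: perm3)
  next
    case 2
    have "add_mset b (mset [b', c', d']) = add_mset b (mset [a, c, d])"
      using eq 2 swap_mset[of a b "{#c, d#}"] by simp
    then have "mset [b', c', d'] = mset [a, c, d]" by simp
    then have "f b b' c' d' = f b a c d" using D by (intro perm3) auto
    also have "\<dots> = f a b c d" using D by (intro s12) auto
    finally show ?thesis using 2 by simp
  next
    case 3
    have "add_mset c (mset [b', c', d']) = add_mset c (mset [a, b, d])"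
      using eq 3 swap_mset[of b c "{#d#}"] swap_mset[of a c "{#b, d#}"] by simp
    then have "mset [b', c', d'] = mset [b, a, d]" using swap_mset[of a b "{#d#}"] by simp
    then have "f c b' c' d' = f c b a d" using D by (intro perm3) auto
    also have "\<dots> = f a b c d" using D by (intro swap_13) auto
    finally show ?thesis using 3 by simp
  next
    case 4
    have "add_mset d (mset [b', c', d']) = add_mset d (mset [a, b, c])"
      using eq 4 swap_mset[of c d "{#}"] swap_mset[of b d "{#c#}"] swap_mset[of a d "{#b, c#}"] by simp
    then have "mset [b', c', d'] = mset [a, b, c]" by simp
    then have "f d b' c' d' = f d a b c" using D by (intro perm3) auto
    also have "\<dots> = f a d b c" using D by (intro s12) auto
    also have "\<dots> = f a b d c" using D by (intro swap_23) auto
    also have "\<dots> = f a b c d" using D by (intro s34) auto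
    finally show ?thesis using 4 by simp
  qed
qed

section \<open>The \<open>q\<close>-difference equation and the expansion\<close>

definition AW_series :: "real \<Rightarrow> complex \<Rightarrow> complex \<Rightarrow> complex \<Rightarrow> complex \<Rightarrow> real \<Rightarrow> complex" where
  "AW_series q a b c d x
    = (\<Sum>n. sigma4 (of_real q) n a b c d / of_real (qpoch q q n) * of_real (q_hermite q n x))"

definition AW_product :: "real \<Rightarrow> complex \<Rightarrow> complex \<Rightarrow> complex \<Rightarrow> complex \<Rightarrow> real \<Rightarrow> complex" where
  "AW_product q a b c d x = (let P = qpoch_inf (complex_of_real q) in
     P (a * b) * P (a * c) * P (a * d) * P (b * c) * P (b * d) * P (c * d) / P (a * b * c * d)
     * phi_h q a x * phi_h q b x * phi_h q c x * phi_h q d x)"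

lemma f_AW_eq_AW_product: "f_AW q a b c d x = of_real (f_h q x) * AW_product q a b c d x"
  by (simp add: f_AW_def AW_product_def Let_def)

text \<open>
  Two solutions of a first-order linear recurrence are proportional: \<open>f 0 * g N = g 0 * f N\<close> for
  all \<open>N\<close>, because the leading coefficient never vanishes. A common nonzero limit forces the factor to be \<open>1\<close>, and \<open>g 0 = 0\<close>
  would make all of \<open>g\<close> vanish.
\<close>

lemma linear_recurrence_eq_of_tendsto:
  fixes f g :: "nat \<Rightarrow> 'a::real_normed_field"
  assumes f: "\<And>N. k N * f (Suc N) = v N * f N" and g: "\<And>N. k N * g (Suc N) = v N * g N"
    and k: "\<And>N. k N \<noteq> 0"
    and lim: "f \<longlonglongrightarrow> l" "g \<longlonglongrightarrow> l" and l: "l \<noteq> 0"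
  shows "f 0 = g 0" "g 0 \<noteq> 0"
proof -
  have cross: "f 0 * g N = g 0 * f N" for N
  proof (induction N)
    case (Suc N)
    have "k N * (f 0 * g (Suc N)) = f 0 * (k N * g (Suc N))" by (rule mult.left_commute)
    also have "\<dots> = v N * (f 0 * g N)" unfolding g by (rule mult.left_commute)
    also have "\<dots> = g 0 * (v N * f N)" unfolding Suc by (rule mult.left_commute)
    also have "\<dots> = k N * (g 0 * f (Suc N))" unfolding f[symmetric] by (rule mult.left_commute)
    finally show ?case using k by simp
  qed simp
  have "(\<lambda>N. f 0 * g N) \<longlonglongrightarrow> f 0 * l" by (intro tendsto_intros lim)
  moreover have "(\<lambda>N. f 0 * g N) \<longlonglongrightarrow> g 0 * l" unfolding cross by (intro tendsto_intros lim)
  ultimately show "f 0 = g 0" using l LIMSEQ_unique by force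
  show "g 0 \<noteq> 0"
  proof
    assume "g 0 = 0"
    have "g N = 0" for N
    proof (induction N)
      case (Suc N)
      then show ?case using g[of N] k[of N] by simp
    qed (rule \<open>g 0 = 0\<close>)
    then have "g = (\<lambda>_. 0)" by (rule ext)
    with lim(2) l show False by (simp add: tendsto_const_iff)
  qed
qed

lemma sigma4_bcd_zero:
  fixes q :: "'a::field"
  assumes nz: "\<And>n. q ^ Suc n \<noteq> 1"
  shows "sigma4 q n a 0 0 0 = a ^ n"
proof -
  have "S2 q m 0 0 = 0" if "m \<noteq> 0" for m
    unfolding S2_def using that by (intro sum.neutral) (auto simp: power_0_left)
  then have "sigma4 q n a 0 0 0 = (\<Sum>j\<in>{n}. qbinom q n j * asw q j a 0 0 0 * S2 q (n - j) 0 0)"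
    unfolding sigma4_altdef by (intro sum.mono_neutral_right) auto
  then show ?thesis
    by (simp add: asw_def asc_c_zero[OF nz] qbinom_def S2_def qpoch_q_nonzero[OF nz])
qed

context
  fixes q x :: real
  assumes q: "\<bar>q\<bar> < 1" and x: "\<bar>x\<bar> \<le> 1"
begin

private abbreviation (input) "Q \<equiv> complex_of_real q"

private abbreviation (input) "H n \<equiv> complex_of_real (q_hermite q n x)"

private abbreviation (input) "G n a b c d \<equiv> sigma4 Q n a b c d / of_real (qpoch q q n)"

lemma normQ: "norm Q < 1"
  using q by simp

lemma Q_nz: "Q ^ Suc n \<noteq> 1"
  by (rule q_power_ne_1[OF normQ])

text \<open>
  The offset \<open>i\<close> allows for the terms \<open>\<sigma>\<^sub>n h\<^bsub>n+1\<^esub>\<close> that arise on multiplication by \<open>2x\<close>. The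
  bound is uniform in the parameters so that it can also dominate the limit \<open>a q^N \<rightarrow> 0\<close>.
\<close>

lemma AW_term_bound:
  assumes r: "0 \<le> r" "r < 1"
  obtains C where "\<And>a b c d n. norm a \<le> r \<Longrightarrow> norm b \<le> r \<Longrightarrow> norm c \<le> r \<Longrightarrow> norm d \<le> r
    \<Longrightarrow> norm (G n a b c d * H (n + i)) \<le> C * (real (Suc n) ^ 4 * r ^ n)"
proof -
  obtain C where "C > 0" and C: "\<And>a b c d n. norm a \<le> r \<Longrightarrow> norm b \<le> r \<Longrightarrow> norm c \<le> r \<Longrightarrow> norm d \<le> r
    \<Longrightarrow> norm (sigma4 Q n a b c d / qpoch Q Q n) \<le> C * (real (Suc n) ^ 3 * r ^ n)"
    using sigma4_bound[OF normQ r] by blast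
  obtain D where "D > 0" and D: "\<And>n. norm (H n) \<le> D * real (Suc n)"
    using q_hermite_bound[OF q x] by blast
  have "norm (G n a b c d * H (n + i)) \<le> C * D * real (Suc i) * (real (Suc n) ^ 4 * r ^ n)"
    if "norm a \<le> r" "norm b \<le> r" "norm c \<le> r" "norm d \<le> r" for a b c d n
  proof -
    have "real (Suc (n + i)) \<le> real (Suc i) * real (Suc n)"
      unfolding of_nat_mult[symmetric] of_nat_le_iff by simp
    then have "D * real (Suc (n + i)) \<le> D * (real (Suc i) * real (Suc n))"
      using \<open>D > 0\<close> by (intro mult_left_mono) auto
    with D[of "n + i"] have "norm (H (n + i)) \<le> D * (real (Suc i) * real (Suc n))"
      by linarith
    then have "norm (G n a b c d * H (n + i))
        \<le> (C * (real (Suc n) ^ 3 * r ^ n)) * (D * (real (Suc i) * real (Suc n)))"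
      unfolding of_real_qpoch norm_mult
      using C[OF that] \<open>C > 0\<close> r by (intro mult_mono) auto
    also have "\<dots> = C * D * real (Suc i) * (real (Suc n) ^ 4 * r ^ n)"
      by (simp only: power3_eq_cube power4_eq_xxxx mult_ac)
    finally show ?thesis .
  qed
  then show ?thesis by (rule that)
qed

lemma AW_summable:
  assumes "norm a < 1" "norm b < 1" "norm c < 1" "norm d < 1"
  shows "summable (\<lambda>n. G n a b c d * H (n + i))"
proof -
  define r where "r = Max {norm a, norm b, norm c, norm d}"
  have r: "norm a \<le> r" "norm b \<le> r" "norm c \<le> r" "norm d \<le> r" "r < 1"
    using assms by (auto simp: r_def)
  then have r0: "0 \<le> r" using norm_ge_zero[of a] by linarith
  obtain C where C: "\<And>a b c d n. norm a \<le> r \<Longrightarrow> norm b \<le> r \<Longrightarrow> norm c \<le> r \<Longrightarrow> norm d \<le> r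
    \<Longrightarrow> norm (G n a b c d * H (n + i)) \<le> C * (real (Suc n) ^ 4 * r ^ n)"
    using AW_term_bound[OF r0 r(5), of i] by blast
  show ?thesis
    by (rule summable_comparison_test'[OF summable_mult[OF summable_poly_geometric[OF r0 r(5), of 4], of C]])
      (rule C[OF r(1-4)])
qed

text \<open>
  Multiplying the series by \<open>2x\<close> and using \<open>2x h\<^sub>n = h\<^bsub>n+1\<^esub> + (1 - q^n) h\<^bsub>n-1\<^esub>\<close> gives the sum of
  the two shifted series \<open>up\<close> and \<open>down\<close>, which are the ones in the contiguous relation.
\<close>

lemma AW_series_q_shift:
  assumes n: "norm a < 1" "norm b < 1" "norm c < 1" "norm d < 1"
  shows "(1 - a * b) * (1 - a * c) * (1 - a * d) * AW_series q (Q * a) b c d x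
    = (1 - a * b * c * d) * ((1 - 2 * a * of_real x + a\<^sup>2) * AW_series q a b c d x)"
proof -
  define k P where "k = (1 - a * b) * (1 - a * c) * (1 - a * d)" and "P = a * b * c * d"
  define g where "g = (\<lambda>n. G n a b c d)"
  define up down where "up = (\<lambda>n. if n = 0 then 0 else g (n - 1) * H n)"
    and "down = (\<lambda>n. if n = 0 then 0 else (1 - Q ^ n) * g n * H (n - 1))"
  have "norm (a * b * c * d) \<le> 1 * 1 * 1 * norm d"
    unfolding norm_mult using n by (intro mult_mono mult_nonneg_nonneg) auto
  then have "norm (a * b * c * d) < 1" using n by simp
  note nzP = mult_q_power_ne_1[OF normQ this]
  have qa: "norm (Q * a) < 1"
  proof -
    have "norm (Q * a) \<le> 1 * norm a"
      unfolding norm_mult using normQ by (intro mult_right_mono) auto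
    then show ?thesis using n by simp
  qed
  have sum_g: "summable (\<lambda>n. g n * H n)"
    using AW_summable[OF n, of 0] by (simp add: g_def)
  have sum_up: "summable up"
    using AW_summable[OF n, of 1] unfolding summable_Suc_iff[of up, symmetric]
    by (simp add: up_def g_def)
  have x_mult: "2 * of_real x * (g n * H n) = up (Suc n) + down n" for n
    by (cases n) (auto simp: up_def down_def algebra_simps)
  have sum_down: "summable down"
  proof -
    have "summable (\<lambda>n. 2 * of_real x * (g n * H n) - up (Suc n))"
      using sum_g sum_up by (intro summable_diff summable_mult) (simp_all add: summable_Suc_iff)
    then show ?thesis unfolding x_mult by simp
  qed
  have AW: "AW_series q a b c d x = (\<Sum>n. g n * H n)"
    by (simp add: AW_series_def g_def)
  have "2 * of_real x * AW_series q a b c d x = (\<Sum>n. up (Suc n) + down n)"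
    unfolding AW using suminf_mult[OF sum_g, of "2 * of_real x"] unfolding x_mult by simp
  also have "\<dots> = (\<Sum>n. up (Suc n)) + suminf down"
    using sum_up sum_down by (intro suminf_add[symmetric]) (simp_all add: summable_Suc_iff)
  also have "(\<Sum>n. up (Suc n)) = suminf up"
    using suminf_split_head[OF sum_up] by (simp add: up_def)
  finally have x_AW: "2 * of_real x * AW_series q a b c d x = suminf up + suminf down" .
  have step: "k * (G n (Q * a) b c d * H n)
      = (1 - P) * ((1 + a\<^sup>2) * (g n * H n) - a * down (Suc n) - a * up n)" for n
  proof -
    have p: "qpoch Q Q n \<noteq> 0" for n by (rule qpoch_q_nonzero[OF Q_nz])
    have g: "sigma4 Q i a b c d = g i * qpoch Q Q i" for i
      using p[of i] by (simp add: g_def of_real_qpoch)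
    have "k * (sigma4 Q n (Q * a) b c d / qpoch Q Q n * H n)
      = (k * sigma4 Q n (Q * a) b c d) * (H n / qpoch Q Q n)" by simp
    also have "\<dots> = (1 - P) * ((1 + a\<^sup>2) * (g n * H n) - a * down (Suc n) - a * up n)"
    proof (cases n)
      case 0
      show ?thesis
        unfolding k_def sigma4_contiguous[OF Q_nz nzP] g P_def down_def up_def 0
        by (simp add: qpoch_Suc algebra_simps)
    next
      case (Suc m)
      have "1 - Q * Q ^ m \<noteq> 0" using Q_nz[of m] by simp
      then show ?thesis
        unfolding k_def sigma4_contiguous[OF Q_nz nzP] g P_def down_def up_def
        using p[of m] by (simp add: Suc qpoch_Suc divide_simps) (simp add: algebra_simps)
    qed
    finally show ?thesis by (simp add: of_real_qpoch)
  qed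
  have "k * AW_series q (Q * a) b c d x = (\<Sum>n. k * (G n (Q * a) b c d * H n))"
    unfolding AW_series_def using AW_summable[OF qa n(2-4), of 0] by (intro suminf_mult[symmetric]) simp
  also have "(\<lambda>n. k * (G n (Q * a) b c d * H n))
      sums ((1 - P) * ((1 + a\<^sup>2) * (\<Sum>n. g n * H n) - a * (\<Sum>n. down (Suc n)) - a * suminf up))"
    unfolding step using sum_g sum_up sum_down
    by (intro sums_mult sums_diff summable_sums) (simp_all add: summable_Suc_iff)
  then have "(\<Sum>n. k * (G n (Q * a) b c d * H n))
      = (1 - P) * ((1 + a\<^sup>2) * (\<Sum>n. g n * H n) - a * (\<Sum>n. down (Suc n)) - a * suminf up)"
    by (rule sums_unique[symmetric])
  also have "(\<Sum>n. down (Suc n)) = suminf down"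
    using suminf_split_head[OF sum_down] by (simp add: down_def)
  also have "(1 + a\<^sup>2) * (\<Sum>n. g n * H n) - a * suminf down - a * suminf up
      = (1 + a\<^sup>2) * AW_series q a b c d x - a * (suminf up + suminf down)"
    by (simp add: AW distrib_left)
  also have "\<dots> = (1 - 2 * a * of_real x + a\<^sup>2) * AW_series q a b c d x"
    unfolding x_AW[symmetric] by (simp add: algebra_simps)
  finally show ?thesis by (simp add: k_def P_def)
qed

lemma q_power_mult_tendsto_0: "(\<lambda>N. Q ^ N * a) \<longlonglongrightarrow> 0"
  using tendsto_mult_right[OF LIMSEQ_power_zero[OF normQ], of a] by simp

lemma norm_q_power_mult_le: "norm (Q ^ N * a) \<le> norm a"
proof -
  have "norm (Q ^ N * a) \<le> 1 * norm a"
    unfolding norm_mult norm_power using normQ by (intro mult_right_mono power_le_one) auto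
  then show ?thesis by simp
qed

text \<open>
  Tannery's theorem, with the uniform bound on the terms.
\<close>

lemma AW_series_tendsto:
  assumes n: "norm a < 1" "norm b < 1" "norm c < 1" "norm d < 1"
  shows "(\<lambda>N. AW_series q (Q ^ N * a) b c d x) \<longlonglongrightarrow> AW_series q 0 b c d x"
proof -
  define r where "r = Max {norm a, norm b, norm c, norm d}"
  have r: "norm a \<le> r" "norm b \<le> r" "norm c \<le> r" "norm d \<le> r" "r < 1"
    using assms by (auto simp: r_def)
  then have r0: "0 \<le> r" using norm_ge_zero[of a] by linarith
  obtain C where C: "\<And>a b c d n. norm a \<le> r \<Longrightarrow> norm b \<le> r \<Longrightarrow> norm c \<le> r \<Longrightarrow> norm d \<le> r
    \<Longrightarrow> norm (G n a b c d * H (n + 0)) \<le> C * (real (Suc n) ^ 4 * r ^ n)"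
    using AW_term_bound[OF r0 r(5), of 0] by blast
  have ra: "norm (Q ^ N * a) \<le> r" for N
    using norm_q_power_mult_le[of N a] r(1) by linarith
  have qpoch: "(\<lambda>N. qpoch Q (Q ^ N * a * u) j) \<longlonglongrightarrow> qpoch Q (0 * u) j" for u j
    unfolding qpoch_def by (intro tendsto_intros q_power_mult_tendsto_0)
  have lim: "(\<lambda>N. G n (Q ^ N * a) b c d * H n) \<longlonglongrightarrow> G n 0 b c d * H n" for n
  proof -
    have "(\<lambda>N. sigma4 Q n (Q ^ N * a) b c d) \<longlonglongrightarrow> sigma4 Q n 0 b c d"
      unfolding sigma4_def mult.assoc[of _ b c] mult.assoc[of _ "b * c" d]
      by (intro tendsto_intros qpoch q_power_mult_tendsto_0) simp
    then show ?thesis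
      by (intro tendsto_intros) (simp_all add: qpoch_q_nonzero[OF Q_nz] of_real_qpoch)
  qed
  have "((\<lambda>N. \<Sum>n. G n (Q ^ N * a) b c d * H n) \<longlongrightarrow> (\<Sum>n. G n 0 b c d * H n)) sequentially"
  proof (rule tannerys_theorem[THEN conjunct2, THEN conjunct2, OF lim])
    show "\<forall>\<^sub>F (n, N) in at_top \<times>\<^sub>F sequentially.
        norm (G n (Q ^ N * a) b c d * H n) \<le> C * (real (Suc n) ^ 4 * r ^ n)"
      using C[OF ra r(2-4)] by (intro always_eventually) auto
    show "summable (\<lambda>n. C * (real (Suc n) ^ 4 * r ^ n))"
      by (intro summable_mult summable_poly_geometric r0 r)
  qed simp
  then show ?thesis by (simp add: AW_series_def)
qed

lemma phi_h_eq_AW_series: "phi_h q t x = AW_series q t 0 0 0 x"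
  by (simp add: phi_h_def AW_series_def sigma4_bcd_zero[OF Q_nz])

lemma AW_series_all_zero: "AW_series q 0 0 0 0 x = 1"
proof -
  have "AW_series q 0 0 0 0 x = (\<Sum>n. 0 ^ n / of_real (qpoch q q n) * H n)"
    by (simp add: AW_series_def sigma4_bcd_zero[OF Q_nz])
  also have "\<dots> = (\<Sum>n\<in>{0}. 0 ^ n / of_real (qpoch q q n) * H n)"
    by (rule suminf_finite) auto
  finally show ?thesis by simp
qed

text \<open>
  Each of the factors \<open>(ab)\<^sub>\<infinity>\<close>, \<open>(ac)\<^sub>\<infinity>\<close>, \<open>(ad)\<^sub>\<infinity>\<close>, \<open>(abcd)\<^sub>\<infinity>\<close> loses its first term under
  \<open>a \<mapsto> qa\<close>, and \<open>\<phi>\<^sub>h\<close>, being a special case of the series, acquires \<open>1 - 2ax + a^2\<close>.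
\<close>

lemma AW_product_q_shift:
  assumes n: "norm a < 1" "norm b < 1" "norm c < 1" "norm d < 1"
  shows "(1 - a * b) * (1 - a * c) * (1 - a * d) * AW_product q (Q * a) b c d x
    = (1 - a * b * c * d) * ((1 - 2 * a * of_real x + a\<^sup>2) * AW_product q a b c d x)"
proof -
  define P where "P = qpoch_inf Q"
  have shift: "P u = (1 - u) * P (Q * u)" for u
    unfolding P_def by (rule qpoch_inf_shift[OF normQ, symmetric])
  have "norm (a * b * c * d) \<le> 1 * 1 * 1 * norm d"
    unfolding norm_mult using n by (intro mult_mono mult_nonneg_nonneg) auto
  then have "1 - a * b * c * d \<noteq> 0" using n by auto
  moreover have "phi_h q (Q * a) x = (1 - 2 * a * of_real x + a\<^sup>2) * phi_h q a x"
    unfolding phi_h_eq_AW_series using AW_series_q_shift[OF n(1), of 0 0 0] by simp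
  ultimately show ?thesis
    unfolding AW_product_def Let_def P_def[symmetric]
    unfolding shift[of "a * b"] shift[of "a * c"] shift[of "a * d"] shift[of "a * b * c * d"]
    by (simp add: mult_ac)
qed

lemma AW_product_tendsto:
  assumes n: "norm a < 1" "norm b < 1" "norm c < 1" "norm d < 1"
  shows "(\<lambda>N. AW_product q (Q ^ N * a) b c d x) \<longlonglongrightarrow> AW_product q 0 b c d x"
proof -
  have P: "(\<lambda>N. qpoch_inf Q (Q ^ N * a * u)) \<longlonglongrightarrow> qpoch_inf Q (0 * u)" if "norm u < 1" for u
    using qpoch_inf_tendsto_1[OF normQ norm_mult_less_1[OF n(1) that]]
    by (simp add: mult.assoc)
  have "(\<lambda>N. phi_h q (Q ^ N * a) x) \<longlonglongrightarrow> phi_h q 0 x"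
    unfolding phi_h_eq_AW_series using n by (intro AW_series_tendsto) auto
  then show ?thesis
    unfolding AW_product_def Let_def mult.assoc[of _ b c] mult.assoc[of _ "b * c" d]
    by (intro tendsto_intros P norm_mult_less_1 n) simp
qed

lemma AW_series_eq_AW_product_step:
  assumes n: "norm a < 1" "norm b < 1" "norm c < 1" "norm d < 1"
    and zero: "AW_series q 0 b c d x = AW_product q 0 b c d x" "AW_product q 0 b c d x \<noteq> 0"
  shows "AW_series q a b c d x = AW_product q a b c d x" "AW_product q a b c d x \<noteq> 0"
proof -
  define k where "k = (\<lambda>N. (1 - Q ^ N * a * b) * (1 - Q ^ N * a * c) * (1 - Q ^ N * a * d))"
  define v where "v = (\<lambda>N. (1 - Q ^ N * a * b * c * d) * (1 - 2 * (Q ^ N * a) * of_real x + (Q ^ N * a)\<^sup>2))"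
  have na: "norm (Q ^ N * a) < 1" for N
    using norm_q_power_mult_le[of N a] n(1) by linarith
  have k: "k N \<noteq> 0" for N
    using norm_mult_less_1[OF na n(2), of N] norm_mult_less_1[OF na n(3), of N]
      norm_mult_less_1[OF na n(4), of N] by (auto simp: k_def)
  have s: "k N * AW_series q (Q ^ Suc N * a) b c d x = v N * AW_series q (Q ^ N * a) b c d x" for N
    using AW_series_q_shift[OF na n(2-4), of N] by (simp add: k_def v_def mult.assoc)
  have p: "k N * AW_product q (Q ^ Suc N * a) b c d x = v N * AW_product q (Q ^ N * a) b c d x" for N
    using AW_product_q_shift[OF na n(2-4), of N] by (simp add: k_def v_def mult.assoc)
  note * = linear_recurrence_eq_of_tendsto[where f = "\<lambda>N. AW_series q (Q ^ N * a) b c d x"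
      and g = "\<lambda>N. AW_product q (Q ^ N * a) b c d x", OF s p k
      AW_series_tendsto[OF n, unfolded zero(1)] AW_product_tendsto[OF n] zero(2)]
  show "AW_series q a b c d x = AW_product q a b c d x" "AW_product q a b c d x \<noteq> 0"
    using * by simp_all
qed

lemma AW_series_swap:
  assumes n: "norm a < 1" "norm b < 1" "norm c < 1" "norm d < 1"
  shows "AW_series q a b c d x = AW_series q c b a d x"
    and "AW_series q a b c d x = AW_series q a d c b x"
    and "AW_series q a b c d x = AW_series q a c b d x"
proof -
  have "norm (a * b * c * d) < 1" using n by (intro norm_mult_less_1)
  note nzP = mult_q_power_ne_1[OF normQ this]
  show "AW_series q a b c d x = AW_series q c b a d x"
    and "AW_series q a b c d x = AW_series q a d c b x"
    and "AW_series q a b c d x = AW_series q a c b d x"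
    unfolding AW_series_def using sigma4_swap_13[OF Q_nz] sigma4_swap_24[OF Q_nz]
      sigma4_swap_23[OF Q_nz nzP] by simp_all
qed

lemma AW_product_swap:
  "AW_product q a b c d x = AW_product q c b a d x"
  "AW_product q a b c d x = AW_product q a d c b x"
  "AW_product q a b c d x = AW_product q a c b d x"
  by (simp_all add: AW_product_def Let_def mult_ac)

text \<open>
  The previous step replaces a zero in the first position by a parameter. Starting from four zeros, it is applied
  four times, and in between the last entry, which is still \<open>0\<close>, is rotated to the front.
\<close>

lemma AW_series_eq_AW_product:
  assumes n: "norm a < 1" "norm b < 1" "norm c < 1" "norm d < 1"
  shows "AW_series q a b c d x = AW_product q a b c d x"
proof -
  define good where "good = (\<lambda>a b c d. AW_series q a b c d x = AW_product q a b c d x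
    \<and> AW_product q a b c d x \<noteq> 0)"
  have step: "good 0 b c d \<Longrightarrow> good a b c d"
    if "norm a < 1" "norm b < 1" "norm c < 1" "norm d < 1" for a b c d
    using AW_series_eq_AW_product_step[OF that] by (simp add: good_def)
  have swap: "good a b c d = good c b a d" "good a b c d = good a d c b" "good a b c d = good a c b d"
    if "{a, b, c, d} \<subseteq> {z. norm z < 1}" for a b c d
    using AW_series_swap[of a b c d] AW_product_swap[of a b c d] that by (simp_all add: good_def)
  have rotate: "good y z w u \<Longrightarrow> good u y z w"
    if n: "norm u < 1" "norm y < 1" "norm z < 1" "norm w < 1" for u y z w
  proof -
    have "good u y z w = good y z w u"
    proof (rule symmetric_4_of_swaps[where f = good and D = "{z. norm z < 1}", OF swap])
      show "mset [u, y, z, w] = mset [y, z, w, u]" by (simp add: multiset_eq_iff)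
    qed (use n in auto)
    then show "good y z w u \<Longrightarrow> good u y z w" by simp
  qed
  have "good 0 0 0 0"
    using AW_series_all_zero by (simp add: good_def AW_product_def phi_h_eq_AW_series)
  then have "good d 0 0 0" using step n by simp
  then have "good 0 d 0 0" using rotate n by simp
  then have "good c d 0 0" using step n by simp
  then have "good 0 c d 0" using rotate n by simp
  then have "good b c d 0" using step n by simp
  then have "good 0 b c d" using rotate n by simp
  then have "good a b c d" using step n by simp
  then show ?thesis by (simp add: good_def)
qed

end

theorem theorem1:
  fixes q x :: real and a b c d :: complex
  assumes "-1 < q" "q < 1"
    and "\<bar>x\<bar> \<le> 1"
    and "norm a < 1" "norm b < 1" "norm c < 1" "norm d < 1"
  shows "summable (\<lambda>n. sigma4 (of_real q) n a b c d / of_real (qpoch q q n) * of_real (q_hermite q n x))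
       \<and> f_AW q a b c d x = of_real (f_h q x) *
           (\<Sum>n. sigma4 (of_real q) n a b c d / of_real (qpoch q q n) * of_real (q_hermite q n x))
       \<and> (\<forall>n a' b' c' d'. mset [a', b', c', d'] = mset [a, b, c, d] \<longrightarrow>
             sigma4 (of_real q) n a' b' c' d' = sigma4 (of_real q) n a b c d)"
proof (intro conjI allI impI)
  have q: "\<bar>q\<bar> < 1" using assms by auto
  then have nq: "norm (complex_of_real q) < 1" by simp
  note x = \<open>\<bar>x\<bar> \<le> 1\<close> and abcd = assms(4-7)
  show "summable (\<lambda>n. sigma4 (of_real q) n a b c d / of_real (qpoch q q n) * of_real (q_hermite q n x))"
    using AW_summable[OF q x abcd, of 0] by simp
  show "f_AW q a b c d x = of_real (f_h q x) *
      (\<Sum>n. sigma4 (of_real q) n a b c d / of_real (qpoch q q n) * of_real (q_hermite q n x))"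
    unfolding f_AW_eq_AW_product AW_series_eq_AW_product[OF q x abcd, symmetric] AW_series_def ..
  fix n a' b' c' d'
  assume eq: "mset [a', b', c', d'] = mset [a, b, c, d]"
  define D where "D = {z::complex. norm z < 1}"
  show "sigma4 (of_real q) n a' b' c' d' = sigma4 (of_real q) n a b c d"
  proof (rule symmetric_4_of_swaps[where f = "sigma4 (complex_of_real q) n" and D = D, OF _ _ _ _ eq])
    fix a b c d :: complex
    assume "{a, b, c, d} \<subseteq> D"
    then have "norm (a * b * c * d) < 1"
      by (intro norm_mult_less_1) (auto simp: D_def)
    from mult_q_power_ne_1[OF nq this]
    show "sigma4 (of_real q) n a b c d = sigma4 (of_real q) n a c b d"
      by (rule sigma4_swap_23[OF q_power_ne_1[OF nq]])
    show "sigma4 (of_real q) n a b c d = sigma4 (of_real q) n c b a d"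
      by (rule sigma4_swap_13[OF q_power_ne_1[OF nq]])
    show "sigma4 (of_real q) n a b c d = sigma4 (of_real q) n a d c b"
      by (rule sigma4_swap_24[OF q_power_ne_1[OF nq]])
  qed (use abcd in \<open>auto simp: D_def\<close>)
qed

end
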